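(* Let $\omega\in\mathbb{R}^\ell$ be Diophantine, and let $A,B,\eta:\mathbb{T}^\ell\to\mathbb{R}$ be real-analytic with $B$ nowhere zero and $A(\theta)/B(\theta)>0$ for all $\theta\in\mathbb{T}^\ell$. Put $L(\theta)=\log\bigl(A(\theta)/B(\theta)\bigr)$, $\overline L=\int_{\mathbb{T}^\ell}L(\theta)\,d\theta$ and $\nu=\exp(\overline L)$. Then: (i) there is a unique real-analytic $L_C:\mathbb{T}^\ell\to\mathbb{R}$ with zero average satisfying $L_C(\theta)-L_C(\theta+\omega)=L(\theta)-\overline L$, and $C(\theta)=\exp(L_C(\theta))$ satisfies $$\frac{A(\theta)}{B(\theta)}=\nu\,\frac{C(\theta)}{C(\theta+\omega)}\qquad\text{for all }\theta\in\mathbb{T}^\ell;$$ (ii) if $\nu\ne1$, then with $\tilde\eta(\theta)=C(\theta+\omega)B(\theta)^{-1}\eta(\theta)$ the equation $\nu W(\theta)-W(\theta+\omega)=\tilde\eta(\theta)$ has a unique real-analytic solution $W:\mathbb{T}^\ell\to\mathbb{R}$, whose Fourier coefficients are $$\widehat W_k=\frac{\widehat{\tilde\eta}_k}{\nu-e^{2\pi i k\cdot\omega}},\qquad k\in\mathbb{Z}^\ell,$$ and $\Delta(\theta)=C(\theta)^{-1}W(\theta)$ solves $$A(\theta)\Delta(\theta)-\Delta(\theta+\omega)B(\theta)=\eta(\theta)\qquad\text{for all }\theta\in\mathbb{T}^\ell.$$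
   Context: $\mathbb{T}^\ell=\mathbb{R}^\ell/\mathbb{Z}^\ell$ with normalized Lebesgue measure, and $\theta+\omega$ is understood modulo $\mathbb{Z}^\ell$. The Fourier coefficients of $f:\mathbb{T}^\ell\to\mathbb{R}$ are $\hat f_k=\int_{\mathbb{T}^\ell}f(\theta)e^{-2\pi i k\cdot\theta}\,d\theta$. The vector $\omega\in\mathbb{R}^\ell$ is called Diophantine if there exist constants $c>0$ and $\tau>0$ such that $|\omega\cdot k-n|^{-1}\le c\,|k|^\tau$ for all $k\in\mathbb{Z}^\ell\setminus\{0\}$ and all $n\in\mathbb{Z}$. *)

theory Defs
  imports "HOL-Analysis.Analysis"
begin

text \<open>
  Functions on the torus $R^l / Z^l$ are represented by their $Z^l$-periodic lifts to
  \<^typ>\<open>real^'l\<close>; the dimension is the cardinality of the finite index type \<open>'l\<close>.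
\<close>

definition ivec :: "int ^ 'l::finite \<Rightarrow> real ^ 'l" where
  "ivec k = (\<chi> i. of_int (k $ i))"

definition torus_periodic :: "(real ^ 'l::finite \<Rightarrow> 'b) \<Rightarrow> bool" where
  "torus_periodic f \<longleftrightarrow> (\<forall>k \<theta>. f (\<theta> + ivec k) = f \<theta>)"

text \<open>
  Real-analyticity in several variables: near each point the function is the sum of an
  (unconditionally convergent) power series indexed by multi-indices \<open>\<alpha> :: 'l \<Rightarrow> nat\<close>.
\<close>

definition real_analytic :: "(real ^ 'l::finite \<Rightarrow> real) \<Rightarrow> bool" where
  "real_analytic f \<longleftrightarrow>
     (\<forall>x. \<exists>r>0. \<exists>a :: ('l \<Rightarrow> nat) \<Rightarrow> real. \<forall>y\<in>ball x r.
        ((\<lambda>\<alpha>. a \<alpha> * (\<Prod>i\<in>UNIV. (y $ i - x $ i) ^ \<alpha> i)) has_sum f y) UNIV)"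

definition torus_analytic :: "(real ^ 'l::finite \<Rightarrow> real) \<Rightarrow> bool" where
  "torus_analytic f \<longleftrightarrow> torus_periodic f \<and> real_analytic f"

text \<open>
  Integration over the torus is Lebesgue integration over the fundamental domain $[0,1]^l$,
  which has measure 1.
\<close>

definition torus_integral ::
    "(real ^ 'l::finite \<Rightarrow> 'b::{banach, second_countable_topology}) \<Rightarrow> 'b" where
  "torus_integral f = (LINT \<theta>:cbox 0 1|lebesgue. f \<theta>)"

definition fourier_coeff :: "(real ^ 'l::finite \<Rightarrow> real) \<Rightarrow> int ^ 'l \<Rightarrow> complex" where
  "fourier_coeff f k =
     torus_integral (\<lambda>\<theta>. of_real (f \<theta>) * exp (- 2 * of_real pi * \<i> * of_real (ivec k \<bullet> \<theta>)))"

text \<open>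
  The bound on the reciprocal presupposes a nonzero denominator; this is stated explicitly
  because \<open>inverse 0 = 0\<close> in HOL. The norm is Euclidean; by equivalence of norms another
  choice only changes the constant \<open>c\<close>.
\<close>

definition diophantine :: "real ^ 'l::finite \<Rightarrow> bool" where
  "diophantine \<omega> \<longleftrightarrow>
     (\<exists>c>0. \<exists>\<tau>>0. \<forall>k. k \<noteq> 0 \<longrightarrow> (\<forall>n::int.
        \<omega> \<bullet> ivec k - of_int n \<noteq> 0 \<and>
        inverse \<bar>\<omega> \<bullet> ivec k - of_int n\<bar> \<le> c * norm (ivec k) powr \<tau>))"

end

theory Submission
  imports Defs
begin

text \<open>
  Write $e_k(\theta) = e^{2\pi i k\cdot\theta}$. Rotation by \<open>\<omega>\<close> multiplies the $k$-th Fourier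
  coefficient by $e_k(\omega)$, so an equation $\mu W(\theta) - W(\theta+\omega) = g(\theta)$ is diagonal
  in the Fourier basis: it says $(\mu - e_k(\omega))\,\hat W_k = \hat g_k$ for every $k$. For \<open>\<mu> = \<nu>\<close>
  positive and different from \<open>1\<close> the divisors stay at distance at least $|\nu-1|$ from zero. For
  \<open>\<mu> = 1\<close> the divisor with $k=0$ vanishes, which is why the right-hand side must have zero average
  and why the average of the solution is free; the others are bounded below by a negative power of
  $|k|$, by the Diophantine condition. In both cases the inverse divisors grow more slowly than every
  exponential of $|k|$.

  Dividing by such divisors keeps a function real-analytic because a periodic function is
  real-analytic exactly when its Fourier coefficients decay exponentially. The decay is
  \<open>fcoeff_decay\<close>: near every point the function expands along each coordinate axis in a power series
  whose coefficients have geometric bounds, uniform over the torus by compactness; integrating this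
  expansion against $e_{-k}$ and comparing it with the exponential series of $e_k(t\,u_i)$, where
  $u_i$ is the $i$-th unit vector, bounds $|k_i|^m\,|\hat f_k|/m!$ geometrically in $m$, and summing over
  $m$ gives the exponential. The converse, \<open>fourier_series_real_analytic\<close>, expands every $e_k$ around
  a point and rearranges the double series. Together with \<open>fourier_inversion\<close> these give
  \<open>multiplier_solution\<close>, from which both existence statements follow; uniqueness holds because a
  continuous periodic function is determined by its Fourier coefficients
  (\<open>fcoeff_zero_imp_zero\<close>).

  The data \<open>L\<close> and \<open>\<eta>'\<close> of the two equations arise from \<open>A\<close>, \<open>B\<close>, \<open>\<eta>\<close> by products, reciprocals,
  logarithms and exponentials. That these preserve analyticity is proved by working with the weighted
  $\ell^1$ norm $\sum_\alpha |a_\alpha|\,s^{|\alpha|}$ of the coefficients, which is submultiplicative: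
  substituting $f$ into a power series of one variable then converges absolutely after shrinking $s$
  so that the norm of $f - f(x)$ lies inside the disc of convergence. The remaining formulas of the
  theorem are algebra: exponentiating the equation for the logarithm gives the formula for $A/B$, and
  inserting that into $A\Delta - \Delta(\cdot+\omega)B$ turns it into
  $B\,C(\cdot+\omega)^{-1}(\nu W - W(\cdot+\omega))$.
\<close>

section \<open>Power series in several variables with weighted absolute convergence\<close>

definition monomial :: "real ^ 'l::finite \<Rightarrow> ('l \<Rightarrow> nat) \<Rightarrow> real" where
  "monomial h \<alpha> = (\<Prod>i\<in>UNIV. (h $ i) ^ \<alpha> i)"

abbreviation mdeg :: "('l::finite \<Rightarrow> nat) \<Rightarrow> nat" where
  "mdeg \<alpha> \<equiv> sum \<alpha> UNIV"

text \<open>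
  The closed cube of half-side \<open>s\<close> replaces the open ball of the definition of analyticity, so that
  one sum dominates the series at all points of the cube. That sum, bounded by \<open>K\<close>, is a
  submultiplicative norm of the coefficients.
\<close>
definition expands ::
    "(real ^ 'l::finite \<Rightarrow> real) \<Rightarrow> real ^ 'l \<Rightarrow> real \<Rightarrow> (('l \<Rightarrow> nat) \<Rightarrow> real) \<Rightarrow> real \<Rightarrow> bool" where
  "expands f x s a K \<longleftrightarrow> s > 0 \<and>
     (\<lambda>\<alpha>. \<bar>a \<alpha>\<bar> * s ^ mdeg \<alpha>) summable_on UNIV \<and>
     (\<Sum>\<^sub>\<infinity>\<alpha>. \<bar>a \<alpha>\<bar> * s ^ mdeg \<alpha>) \<le> K \<and>
     (\<forall>h. (\<forall>i. \<bar>h $ i\<bar> \<le> s) \<longrightarrow> ((\<lambda>\<alpha>. a \<alpha> * monomial h \<alpha>) has_sum f (x + h)) UNIV)"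

lemma monomial_add: "monomial h (\<lambda>i. \<alpha> i + \<beta> i) = monomial h \<alpha> * monomial h \<beta>"
  by (simp add: monomial_def power_add prod.distrib)

lemma monomial_bound:
  assumes "\<And>i. \<bar>h $ i\<bar> \<le> s"
  shows "\<bar>monomial h \<alpha>\<bar> \<le> s ^ mdeg \<alpha>"
proof -
  have "\<bar>monomial h \<alpha>\<bar> = (\<Prod>i\<in>UNIV. \<bar>h $ i\<bar> ^ \<alpha> i)"
    by (simp add: monomial_def abs_prod power_abs)
  also have "\<dots> \<le> (\<Prod>i\<in>UNIV. s ^ \<alpha> i)"
    by (intro prod_mono conjI power_mono assms) auto
  also have "\<dots> = s ^ mdeg \<alpha>" by (simp add: power_sum)
  finally show ?thesis .
qed

lemma monomial_diagonal: "monomial (\<chi> i. s) \<alpha> = s ^ mdeg \<alpha>"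
  by (simp add: monomial_def power_sum)

lemma monomial_at_0: "monomial 0 \<alpha> = (if \<alpha> = (\<lambda>_. 0) then 1 else 0)"
  by (auto simp: monomial_def fun_eq_iff)

lemma summable_on_abs_real:
  fixes f :: "'p \<Rightarrow> real"
  assumes "f summable_on S"
  shows "(\<lambda>p. \<bar>f p\<bar>) summable_on S"
  using iffD1[OF summable_on_iff_abs_summable_on_real assms] by simp

text \<open>
  Unconditional convergence of real series is absolute, so convergence at the corner
  $(s,\dots,s)$ of a cube inside the ball already bounds the weighted sum of the coefficients.
\<close>
lemma real_analytic_imp_expands:
  assumes "real_analytic f"
  shows "\<exists>s a K. expands f x s a K"
proof -
  obtain r a where r: "r > 0" and a: "\<And>y. y \<in> ball x r \<Longrightarrow>
        ((\<lambda>\<alpha>. a \<alpha> * (\<Prod>i\<in>UNIV. (y $ i - x $ i) ^ \<alpha> i)) has_sum f y) UNIV"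
    using assms unfolding real_analytic_def by blast
  define s where "s = r / (real CARD('a) + 1)"
  have s: "s > 0" using r by (simp add: s_def)
  have ball: "x + h \<in> ball x r" if "\<And>i. \<bar>h $ i\<bar> \<le> s" for h
  proof -
    have "norm h \<le> (\<Sum>i\<in>UNIV. \<bar>h $ i\<bar>)" by (rule norm_le_l1_cart)
    also have "\<dots> \<le> (\<Sum>i\<in>(UNIV::'a set). s)" by (intro sum_mono that)
    also have "\<dots> < r" using r by (simp add: s_def field_simps)
    finally show ?thesis by (simp add: dist_norm)
  qed
  have sm: "((\<lambda>\<alpha>. a \<alpha> * monomial h \<alpha>) has_sum f (x + h)) UNIV" if "\<And>i. \<bar>h $ i\<bar> \<le> s" for h
    using a[OF ball[OF that]] by (simp add: monomial_def)
  have "(\<lambda>\<alpha>. a \<alpha> * s ^ mdeg \<alpha>) summable_on UNIV"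
    using has_sum_imp_summable[OF sm[of "\<chi> i. s"]] s by (simp add: monomial_diagonal)
  then have "(\<lambda>\<alpha>. \<bar>a \<alpha>\<bar> * s ^ mdeg \<alpha>) summable_on UNIV"
    using s by (auto dest: summable_on_abs_real simp: abs_mult)
  with s sm show ?thesis unfolding expands_def by blast
qed

lemma expands_imp_real_analytic:
  assumes "\<And>x. \<exists>s a K. expands f x s a K"
  shows "real_analytic f"
  unfolding real_analytic_def
proof
  fix x
  obtain s a K where e: "expands f x s a K" using assms by blast
  have "((\<lambda>\<alpha>. a \<alpha> * (\<Prod>i\<in>UNIV. (y $ i - x $ i) ^ \<alpha> i)) has_sum f y) UNIV"
    if y: "y \<in> ball x s" for y
  proof -
    have "\<bar>(y - x) $ i\<bar> \<le> s" for i
    proof -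
      have "\<bar>(y - x) $ i\<bar> \<le> norm (y - x)" by (rule component_le_norm_cart)
      also have "\<dots> \<le> s" using y by (simp add: dist_norm norm_minus_commute)
      finally show ?thesis .
    qed
    then have "((\<lambda>\<alpha>. a \<alpha> * monomial (y - x) \<alpha>) has_sum f (x + (y - x))) UNIV"
      using e unfolding expands_def by blast
    then show ?thesis by (simp add: monomial_def)
  qed
  with e show "\<exists>r>0. \<exists>a. \<forall>y\<in>ball x r.
        ((\<lambda>\<alpha>. a \<alpha> * (\<Prod>i\<in>UNIV. (y $ i - x $ i) ^ \<alpha> i)) has_sum f y) UNIV"
    unfolding expands_def by blast
qed

lemma has_sum_fibers:
  fixes f :: "'p \<Rightarrow> 'b::banach" and m :: "'p \<Rightarrow> 'q"
  assumes "(f has_sum S) UNIV"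
  shows "((\<lambda>q. infsum f {p. m p = q}) has_sum S) UNIV"
proof -
  have "bij_betw (\<lambda>p. (m p, p)) UNIV (SIGMA q:UNIV. {p. m p = q})"
    by (auto simp: bij_betw_def inj_on_def)
  then have 1: "((\<lambda>z. f (snd z)) has_sum S) (SIGMA q:UNIV. {p. m p = q})"
    using assms has_sum_reindex_bij_betw[of "\<lambda>p. (m p, p)" UNIV _ "\<lambda>z. f (snd z)" S] by simp
  have "f summable_on {p. m p = q}" for q
    using assms summable_on_subset_banach[of f UNIV] has_sum_imp_summable by blast
  then have "((\<lambda>p. f (snd (q, p))) has_sum infsum f {p. m p = q}) {p. m p = q}" for q by simp
  from has_sum_SigmaD[OF 1 this] show ?thesis by simp
qed

text \<open>
  Products, compositions and Fourier series are expanded through this lemma: a series of monomials in which the same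
  multi-index may occur for many indices \<open>p\<close> becomes a power series after collecting the terms of
  each fibre of \<open>m\<close>, and the absolute sum \<open>K\<close> survives as a bound. Products use pairs of
  multi-indices, compositions use pairs of an exponent and a multi-index, and Fourier series use pairs
  of a frequency and a multi-index.
\<close>
lemma expands_group:
  fixes m :: "'p \<Rightarrow> ('l::finite \<Rightarrow> nat)"
  assumes s: "s > 0"
    and K: "((\<lambda>p. \<bar>c p\<bar> * s ^ mdeg (m p)) has_sum K) UNIV"
    and f: "\<And>h. (\<And>i. \<bar>h $ i\<bar> \<le> s) \<Longrightarrow> ((\<lambda>p. c p * monomial h (m p)) has_sum f (x + h)) UNIV"
  shows "expands f x s (\<lambda>\<alpha>. infsum c {p. m p = \<alpha>}) K"
proof -
  let ?F = "\<lambda>\<alpha>. {p. m p = \<alpha>}"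
  have abs_fib: "(\<lambda>p. \<bar>c p\<bar>) summable_on ?F \<alpha>" for \<alpha>
  proof -
    have "(\<lambda>p. \<bar>c p\<bar> * s ^ mdeg (m p)) summable_on ?F \<alpha>"
      using K summable_on_subset_banach[of _ UNIV] has_sum_imp_summable by blast
    then have "(\<lambda>p. \<bar>c p\<bar> * s ^ mdeg \<alpha>) summable_on ?F \<alpha>"
      by (rule summable_on_cong[THEN iffD1, rotated]) auto
    then show ?thesis using s by (simp add: summable_on_cmult_left')
  qed
  have le: "\<bar>infsum c (?F \<alpha>)\<bar> * s ^ mdeg \<alpha> \<le> infsum (\<lambda>p. \<bar>c p\<bar> * s ^ mdeg (m p)) (?F \<alpha>)" for \<alpha>
  proof -
    have "\<bar>infsum c (?F \<alpha>)\<bar> \<le> infsum (\<lambda>p. \<bar>c p\<bar>) (?F \<alpha>)"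
      using norm_infsum_bound[of c "?F \<alpha>"] abs_fib by simp
    then have "\<bar>infsum c (?F \<alpha>)\<bar> * s ^ mdeg \<alpha> \<le> infsum (\<lambda>p. \<bar>c p\<bar>) (?F \<alpha>) * s ^ mdeg \<alpha>"
      using s by (intro mult_right_mono) auto
    also have "\<dots> = infsum (\<lambda>p. \<bar>c p\<bar> * s ^ mdeg \<alpha>) (?F \<alpha>)"
      by (simp add: infsum_cmult_left')
    also have "\<dots> = infsum (\<lambda>p. \<bar>c p\<bar> * s ^ mdeg (m p)) (?F \<alpha>)"
      by (rule infsum_cong) auto
    finally show ?thesis .
  qed
  note G = has_sum_fibers[OF K, of m]
  have sm: "(\<lambda>\<alpha>. \<bar>infsum c (?F \<alpha>)\<bar> * s ^ mdeg \<alpha>) summable_on UNIV"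
    by (rule summable_on_comparison_test[OF has_sum_imp_summable[OF G] le]) (use s in auto)
  have "(\<Sum>\<^sub>\<infinity>\<alpha>. \<bar>infsum c (?F \<alpha>)\<bar> * s ^ mdeg \<alpha>) \<le> K"
    using has_sum_mono[OF has_sum_infsum[OF sm] G le] .
  moreover have "((\<lambda>\<alpha>. infsum c (?F \<alpha>) * monomial h \<alpha>) has_sum f (x + h)) UNIV"
    if "\<forall>i. \<bar>h $ i\<bar> \<le> s" for h
  proof -
    have "((\<lambda>\<alpha>. infsum (\<lambda>p. c p * monomial h (m p)) (?F \<alpha>)) has_sum f (x + h)) UNIV"
      using has_sum_fibers[OF f] that by blast
    moreover have "infsum (\<lambda>p. c p * monomial h (m p)) (?F \<alpha>) = infsum c (?F \<alpha>) * monomial h \<alpha>" for \<alpha>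
    proof -
      have "infsum (\<lambda>p. c p * monomial h (m p)) (?F \<alpha>) = infsum (\<lambda>p. c p * monomial h \<alpha>) (?F \<alpha>)"
        by (rule infsum_cong) auto
      then show ?thesis by (simp add: infsum_cmult_left')
    qed
    ultimately show ?thesis by simp
  qed
  ultimately show ?thesis using s sm unfolding expands_def by blast
qed

lemma has_sum_product_nonneg:
  fixes u :: "'p \<Rightarrow> real" and v :: "'q \<Rightarrow> real"
  assumes u: "(u has_sum U) UNIV" and v: "(v has_sum V) UNIV"
    and nonneg: "\<And>p. u p \<ge> 0" "\<And>q. v q \<ge> 0"
  shows "((\<lambda>z. u (fst z) * v (snd z)) has_sum U * V) UNIV"
proof -
  have 1: "((\<lambda>q. u (fst (p, q)) * v (snd (p, q))) has_sum u p * V) UNIV" for p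
    using has_sum_cmult_right[OF v, of "u p"] by simp
  have 2: "((\<lambda>p. u p * V) has_sum U * V) UNIV" by (rule has_sum_cmult_left[OF u])
  have "(\<lambda>z. u (fst z) * v (snd z)) summable_on UNIV \<times> UNIV"
    by (rule summable_on_SigmaI[where g = "\<lambda>p. u p * V"])
      (use 1 has_sum_imp_summable[OF 2] nonneg in auto)
  from has_sum_SigmaI[OF _ 2 this] 1 show ?thesis by simp
qed

lemma has_sum_product:
  fixes u :: "'p \<Rightarrow> real" and v :: "'q \<Rightarrow> real"
  assumes u: "(u has_sum U) UNIV" and v: "(v has_sum V) UNIV"
  shows "((\<lambda>z. u (fst z) * v (snd z)) has_sum U * V) UNIV"
proof -
  have 1: "((\<lambda>q. u (fst (p, q)) * v (snd (p, q))) has_sum u p * V) UNIV" for p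
    using has_sum_cmult_right[OF v, of "u p"] by simp
  have 2: "((\<lambda>p. u p * V) has_sum U * V) UNIV" by (rule has_sum_cmult_left[OF u])
  have au: "(\<lambda>p. \<bar>u p\<bar>) summable_on UNIV" and av: "(\<lambda>q. \<bar>v q\<bar>) summable_on UNIV"
    using has_sum_imp_summable[OF u] has_sum_imp_summable[OF v] by (auto intro: summable_on_abs_real)
  have "(\<lambda>z. \<bar>u (fst z)\<bar> * \<bar>v (snd z)\<bar>) summable_on UNIV"
    by (rule has_sum_imp_summable[OF has_sum_product_nonneg[OF has_sum_infsum[OF au] has_sum_infsum[OF av]]]) auto
  then have "(\<lambda>z. norm (u (fst z) * v (snd z))) summable_on UNIV \<times> UNIV" by (simp add: abs_mult)
  then have "(\<lambda>z. u (fst z) * v (snd z)) summable_on UNIV \<times> UNIV" by (rule abs_summable_summable)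
  from has_sum_SigmaI[OF _ 2 this] 1 show ?thesis by simp
qed

lemma expands_mono: "expands f x s a K \<Longrightarrow> K \<le> K' \<Longrightarrow> expands f x s a K'"
  unfolding expands_def by auto

lemma expands_nonneg: "expands f x s a K \<Longrightarrow> 0 \<le> K"
  unfolding expands_def
  by (auto intro: order_trans[OF infsum_nonneg[of UNIV "\<lambda>\<alpha>. \<bar>a \<alpha>\<bar> * s ^ mdeg \<alpha>"]])

lemma expands_shrink:
  assumes e: "expands f x s a K" and s': "0 < s'" "s' \<le> s"
  shows "expands f x s' a K"
proof -
  have le: "\<bar>a \<alpha>\<bar> * s' ^ mdeg \<alpha> \<le> \<bar>a \<alpha>\<bar> * s ^ mdeg \<alpha>" for \<alpha>
    using s' by (intro mult_left_mono power_mono) auto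
  have sm: "(\<lambda>\<alpha>. \<bar>a \<alpha>\<bar> * s ^ mdeg \<alpha>) summable_on UNIV" and
     K: "(\<Sum>\<^sub>\<infinity>\<alpha>. \<bar>a \<alpha>\<bar> * s ^ mdeg \<alpha>) \<le> K" using e unfolding expands_def by auto
  have sm': "(\<lambda>\<alpha>. \<bar>a \<alpha>\<bar> * s' ^ mdeg \<alpha>) summable_on UNIV"
    by (rule summable_on_comparison_test[OF sm le]) (use s' in auto)
  have "(\<Sum>\<^sub>\<infinity>\<alpha>. \<bar>a \<alpha>\<bar> * s' ^ mdeg \<alpha>) \<le> K"
    using infsum_mono[OF sm' sm le] K by simp
  with sm' e s' show ?thesis unfolding expands_def by (meson order_trans)
qed

lemma expands_mult:
  assumes f: "expands f x s a K" and g: "expands g x s b M"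
  shows "\<exists>c. expands (\<lambda>y. f y * g y) x s c (K * M)"
proof -
  let ?U = "\<Sum>\<^sub>\<infinity>\<alpha>. \<bar>a \<alpha>\<bar> * s ^ mdeg \<alpha>" and ?V = "\<Sum>\<^sub>\<infinity>\<alpha>. \<bar>b \<alpha>\<bar> * s ^ mdeg \<alpha>"
  have s: "s > 0" using f by (simp add: expands_def)
  have U: "((\<lambda>\<alpha>. \<bar>a \<alpha>\<bar> * s ^ mdeg \<alpha>) has_sum ?U) UNIV" 
    and V: "((\<lambda>\<alpha>. \<bar>b \<alpha>\<bar> * s ^ mdeg \<alpha>) has_sum ?V) UNIV"
    using f g unfolding expands_def by auto
  have *: "expands (\<lambda>y. f y * g y) x s
      (\<lambda>\<gamma>. infsum (\<lambda>z. a (fst z) * b (snd z)) {z. (\<lambda>i. fst z i + snd z i) = \<gamma>}) (?U * ?V)"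
  proof (rule expands_group[OF s])
    show "((\<lambda>z. \<bar>a (fst z) * b (snd z)\<bar> * s ^ mdeg (\<lambda>i. fst z i + snd z i)) has_sum ?U * ?V) UNIV"
      using has_sum_product_nonneg[OF U V] s
      by (simp add: abs_mult sum.distrib power_add mult_ac)
    show "((\<lambda>z. a (fst z) * b (snd z) * monomial h (\<lambda>i. fst z i + snd z i)) has_sum f (x + h) * g (x + h)) UNIV"
      if "\<And>i. \<bar>h $ i\<bar> \<le> s" for h
    proof -
      have "((\<lambda>\<alpha>. a \<alpha> * monomial h \<alpha>) has_sum f (x + h)) UNIV"
        and "((\<lambda>\<alpha>. b \<alpha> * monomial h \<alpha>) has_sum g (x + h)) UNIV"
        using f g that unfolding expands_def by auto
      from has_sum_product[OF this] show ?thesis by (simp add: monomial_add mult_ac)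
    qed
  qed
  have "?U * ?V \<le> K * M"
  proof (rule mult_mono)
    show "0 \<le> ?V" using s by (intro infsum_nonneg) auto
  qed (use f g expands_nonneg[OF f] in \<open>auto simp: expands_def\<close>)
  from expands_mono[OF * this] show ?thesis by blast
qed

lemma expands_one:
  assumes "s > 0"
  shows "expands (\<lambda>_. 1) x s (\<lambda>\<alpha>. if \<alpha> = (\<lambda>_. 0) then 1 else 0) 1"
proof -
  have "((\<lambda>\<alpha>::'a\<Rightarrow>nat. \<bar>if \<alpha> = (\<lambda>_. 0) then 1 else 0\<bar> * s ^ mdeg \<alpha>) has_sum 1) UNIV"
    by (rule has_sum_finite_neutralI[where B = "{\<lambda>_. 0}"]) auto
  moreover have "((\<lambda>\<alpha>. (if \<alpha> = (\<lambda>_. 0) then 1 else 0) * monomial h \<alpha>) has_sum 1) UNIV" for h :: "real^'a"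
    by (rule has_sum_finite_neutralI[where B = "{\<lambda>_. 0}"]) (auto simp: monomial_def)
  ultimately show ?thesis using assms
    unfolding expands_def by (auto simp: has_sum_iff)
qed

lemma expands_power:
  assumes "expands f x s a K"
  shows "\<exists>c. expands (\<lambda>y. f y ^ n) x s c (K ^ n)"
proof (induction n)
  case 0
  have "s > 0" using assms by (simp add: expands_def)
  from expands_one[OF this, of x] show ?case by simp blast
next
  case (Suc n)
  then obtain c where "expands (\<lambda>y. f y ^ n) x s c (K ^ n)" by blast
  from expands_mult[OF assms this] show ?case by simp
qed

text \<open>
  The deviation has no constant term, so shrinking the radius by a factor \<open>q \<le> 1\<close> shrinks its
  weighted norm by at least that factor.
\<close>
lemma expands_deviation:
  assumes e: "expands f x s a K" and \<epsilon>: "\<epsilon> > 0"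
  shows "\<exists>s'. \<exists>a'. expands (\<lambda>y. f y - f x) x s' a' \<epsilon>"
proof -
  have s: "s > 0" and K: "0 \<le> K" using expands_nonneg[OF e] e by (simp_all add: expands_def)
  \<comment> \<open>The summand \<open>1\<close> covers the case \<open>K = 0\<close>.\<close>
  define q where "q = min 1 (\<epsilon> / (K + 1))"
  define s' where "s' = q * s"
  have q: "0 < q" "q \<le> 1" "q * K \<le> \<epsilon>"
  proof -
    show "0 < q" "q \<le> 1" using \<epsilon> K by (auto simp: q_def)
    have "q * K \<le> \<epsilon> / (K + 1) * K" using K by (intro mult_right_mono) (auto simp: q_def)
    also have "\<dots> \<le> \<epsilon>" using K \<epsilon> by (simp add: field_simps)
    finally show "q * K \<le> \<epsilon>" .
  qed
  have s': "0 < s'" "s' \<le> s" using q s by (auto simp: s'_def mult_le_cancel_right1)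
  define a' where "a' = a((\<lambda>_. 0) := 0)"
  have le: "\<bar>a' \<alpha>\<bar> * s' ^ mdeg \<alpha> \<le> q * (\<bar>a \<alpha>\<bar> * s ^ mdeg \<alpha>)" for \<alpha>
  proof (cases "\<alpha> = (\<lambda>_. 0)")
    case True then show ?thesis using q s by (simp add: a'_def)
  next
    case False
    then obtain i where "\<alpha> i \<noteq> 0" by auto
    then have "mdeg \<alpha> \<ge> 1" using member_le_sum[of i UNIV \<alpha>] by simp
    then have "q ^ mdeg \<alpha> \<le> q ^ 1" using q by (intro power_decreasing) auto
    then have "\<bar>a \<alpha>\<bar> * s ^ mdeg \<alpha> * q ^ mdeg \<alpha> \<le> \<bar>a \<alpha>\<bar> * s ^ mdeg \<alpha> * q"
      using s by (intro mult_left_mono) auto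
    then show ?thesis using False by (simp add: a'_def s'_def power_mult_distrib mult_ac)
  qed
  have sm: "(\<lambda>\<alpha>. \<bar>a \<alpha>\<bar> * s ^ mdeg \<alpha>) summable_on UNIV" and
     KK: "(\<Sum>\<^sub>\<infinity>\<alpha>. \<bar>a \<alpha>\<bar> * s ^ mdeg \<alpha>) \<le> K" using e unfolding expands_def by auto
  have smq: "(\<lambda>\<alpha>. q * (\<bar>a \<alpha>\<bar> * s ^ mdeg \<alpha>)) summable_on UNIV"
    using sm by (rule summable_on_cmult_right)
  have sm': "(\<lambda>\<alpha>. \<bar>a' \<alpha>\<bar> * s' ^ mdeg \<alpha>) summable_on UNIV"
    by (rule summable_on_comparison_test[OF smq le]) (use s' in auto)
  have "(\<Sum>\<^sub>\<infinity>\<alpha>. \<bar>a' \<alpha>\<bar> * s' ^ mdeg \<alpha>) \<le> (\<Sum>\<^sub>\<infinity>\<alpha>. q * (\<bar>a \<alpha>\<bar> * s ^ mdeg \<alpha>))"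
    by (rule infsum_mono[OF sm' smq le])
  also have "\<dots> = q * (\<Sum>\<^sub>\<infinity>\<alpha>. \<bar>a \<alpha>\<bar> * s ^ mdeg \<alpha>)" by (rule infsum_cmult_right')
  also have "\<dots> \<le> \<epsilon>" using KK q by (meson less_imp_le mult_left_mono order_trans)
  finally have bd: "(\<Sum>\<^sub>\<infinity>\<alpha>. \<bar>a' \<alpha>\<bar> * s' ^ mdeg \<alpha>) \<le> \<epsilon>" .
  have a0: "a (\<lambda>_. 0) = f x"
  proof -
    have "((\<lambda>\<alpha>. a \<alpha> * monomial 0 \<alpha>) has_sum f (x + 0)) UNIV"
      using e s unfolding expands_def by (metis abs_zero less_imp_le zero_index)
    moreover have "((\<lambda>\<alpha>. a \<alpha> * monomial 0 \<alpha>) has_sum a (\<lambda>_. 0)) UNIV"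
      by (rule has_sum_finite_neutralI[where B = "{\<lambda>_. 0}"]) (auto simp: monomial_at_0)
    ultimately show ?thesis using has_sum_unique by force
  qed
  have "((\<lambda>\<alpha>. a' \<alpha> * monomial h \<alpha>) has_sum f (x + h) - f x) UNIV" if h: "\<forall>i. \<bar>h $ i\<bar> \<le> s'" for h
  proof -
    have 1: "((\<lambda>\<alpha>. a \<alpha> * monomial h \<alpha>) has_sum f (x + h)) UNIV"
      using e h s'(2) unfolding expands_def by (meson order_trans)
    have 2: "((\<lambda>\<alpha>. if \<alpha> = (\<lambda>_. 0) then - f x else 0) has_sum - f x) UNIV"
      by (rule has_sum_finite_neutralI[where B = "{\<lambda>_. 0}"]) auto
    have "(\<lambda>\<alpha>. a \<alpha> * monomial h \<alpha> + (if \<alpha> = (\<lambda>_. 0) then - f x else 0)) = (\<lambda>\<alpha>. a' \<alpha> * monomial h \<alpha>)"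
      using a0 by (auto simp: a'_def monomial_def)
    then show ?thesis using has_sum_add[OF 1 2] by simp
  qed
  then show ?thesis using s' sm' bd unfolding expands_def by blast
qed

text \<open>
  Once the deviation \<open>f - f x\<close> has norm at most half of \<open>\<rho>\<close>, its powers have norms at most
  \<open>(\<rho>/2) ^ n\<close>, and the outer power series converges absolutely there; this dominates the double
  series over \<open>n\<close> and the multi-index.
\<close>
lemma expands_compose:
  fixes f :: "real ^ 'l::finite \<Rightarrow> real"
  assumes e: "expands f x s a K" and \<rho>: "\<rho> > 0"
    and g: "\<And>u. \<bar>u\<bar> < \<rho> \<Longrightarrow> (\<lambda>n. b n * u ^ n) sums g (f x + u)"
  shows "\<exists>s' c K'. expands (\<lambda>y. g (f y)) x s' c K'"
proof -
  define \<epsilon> where "\<epsilon> = \<rho> / 2"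
  have \<epsilon>: "0 < \<epsilon>" "\<epsilon> < \<rho>" using \<rho> by (auto simp: \<epsilon>_def)
  have abs_conv: "summable (\<lambda>n. \<bar>b n * u ^ n\<bar>)" if "\<bar>u\<bar> \<le> \<epsilon>" for u
  proof -
    have "summable (\<lambda>n. b n * ((\<epsilon> + \<rho>) / 2) ^ n)"
      using g[of "(\<epsilon> + \<rho>) / 2"] \<epsilon> sums_summable by fastforce
    then have "summable (\<lambda>n. norm (b n * u ^ n))"
      by (rule powser_insidea) (use that \<epsilon> in auto)
    then show ?thesis by simp
  qed
  obtain s' a' where e': "expands (\<lambda>y. f y - f x) x s' a' \<epsilon>"
    using expands_deviation[OF e \<epsilon>(1)] by blast
  obtain c where c: "\<And>n. expands (\<lambda>y. (f y - f x) ^ n) x s' (c n) (\<epsilon> ^ n)"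
    using expands_power[OF e'] by metis
  have s': "s' > 0" using e' by (simp add: expands_def)
  define U where "U n = (\<Sum>\<^sub>\<infinity>\<alpha>. \<bar>c n \<alpha>\<bar> * s' ^ mdeg \<alpha>)" for n
  have U: "((\<lambda>\<alpha>. \<bar>c n \<alpha>\<bar> * s' ^ mdeg \<alpha>) has_sum U n) UNIV" "0 \<le> U n" "U n \<le> \<epsilon> ^ n" for n
    using c[of n] s' unfolding expands_def U_def by (auto intro!: infsum_nonneg)
  let ?w = "\<lambda>z. \<bar>b (fst z) * c (fst z) (snd z)\<bar> * s' ^ mdeg (snd z)"
  have w1: "((\<lambda>\<alpha>. ?w (n, \<alpha>)) has_sum \<bar>b n\<bar> * U n) UNIV" for n
    using has_sum_cmult_right[OF U(1), of "\<bar>b n\<bar>" n] by (simp add: abs_mult mult_ac)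
  have w2: "(\<lambda>n. \<bar>b n\<bar> * U n) summable_on UNIV"
  proof (rule summable_on_comparison_test)
    show "(\<lambda>n. \<bar>b n * \<epsilon> ^ n\<bar>) summable_on UNIV"
      using abs_conv[of \<epsilon>] \<epsilon> by (subst summable_on_UNIV_nonneg_real_iff) auto
    show "\<bar>b n\<bar> * U n \<le> \<bar>b n * \<epsilon> ^ n\<bar>" for n using U(3)[of n] \<epsilon>
      by (simp add: abs_mult mult_left_mono)
  qed (use U(2) in auto)
  have w: "?w summable_on UNIV \<times> UNIV"
    by (rule summable_on_SigmaI[OF w1 w2]) (use s' in auto)
  have "expands (\<lambda>y. g (f y)) x s'
     (\<lambda>\<gamma>. infsum (\<lambda>z. b (fst z) * c (fst z) (snd z)) {z. snd z = \<gamma>}) (infsum ?w UNIV)"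
  proof (rule expands_group[OF s'])
    show "(?w has_sum infsum ?w UNIV) UNIV" using w by simp
    fix h :: "real ^ 'l" assume h: "\<And>i. \<bar>h $ i\<bar> \<le> s'"
    define u where "u = f (x + h) - f x"
    let ?v = "\<lambda>z. b (fst z) * c (fst z) (snd z) * monomial h (snd z)"
    have cu: "((\<lambda>\<alpha>. c n \<alpha> * monomial h \<alpha>) has_sum u ^ n) UNIV" for n
      using c[of n] h unfolding expands_def u_def by blast
    have u: "\<bar>u\<bar> \<le> \<epsilon>"
    proof -
      have n1: "((\<lambda>\<alpha>. c 1 \<alpha> * monomial h \<alpha>) has_sum u) UNIV" using cu[of 1] by simp
      have n2: "norm (c 1 \<alpha> * monomial h \<alpha>) \<le> \<bar>c 1 \<alpha>\<bar> * s' ^ mdeg \<alpha>" for \<alpha>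
        using monomial_bound[OF h, of \<alpha>] by (simp add: abs_mult mult_left_mono)
      have "norm u \<le> U 1" by (rule norm_infsum_le[OF n1 U(1) n2])
      with U(3)[of 1] show ?thesis by simp
    qed
    have v1: "((\<lambda>\<alpha>. ?v (n, \<alpha>)) has_sum b n * u ^ n) UNIV" for n
      using has_sum_cmult_right[OF cu, of "b n" n] by (simp add: mult_ac)
    have v2: "((\<lambda>n. b n * u ^ n) has_sum g (f x + u)) UNIV"
      using abs_conv[OF u] g[of u] u \<epsilon> by (intro norm_summable_imp_has_sum) auto
    have "(\<lambda>z. norm (?v z)) summable_on UNIV \<times> UNIV"
      using w by (rule Infinite_Sum.abs_summable_on_comparison_test')
        (simp add: abs_mult mult_left_mono monomial_bound[OF h])
    then have "?v summable_on UNIV \<times> UNIV" by (rule abs_summable_summable)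
    from has_sum_SigmaI[OF v1 v2 this] show "(?v has_sum g (f (x + h))) UNIV"
      by (simp add: u_def)
  qed
  then show ?thesis by blast
qed

section \<open>Closure properties of real-analytic functions\<close>

lemma real_analytic_compose:
  assumes f: "real_analytic f"
    and g: "\<And>x. \<exists>\<rho>>0. \<exists>b. \<forall>u. \<bar>u\<bar> < \<rho> \<longrightarrow> (\<lambda>n. b n * u ^ n) sums g (f x + u)"
  shows "real_analytic (\<lambda>x. g (f x))"
proof (rule expands_imp_real_analytic)
  fix x
  obtain s a K where "expands f x s a K" using real_analytic_imp_expands[OF f] by blast
  moreover obtain \<rho> b where "\<rho> > 0" "\<And>u. \<bar>u\<bar> < \<rho> \<Longrightarrow> (\<lambda>n. b n * u ^ n) sums g (f x + u)"
    using g[of x] by blast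
  ultimately show "\<exists>s a K. expands (\<lambda>x. g (f x)) x s a K" by (rule expands_compose)
qed

lemma real_analytic_mult:
  assumes "real_analytic f" "real_analytic g"
  shows "real_analytic (\<lambda>x. f x * g x)"
proof (rule expands_imp_real_analytic)
  fix x
  obtain s a K where f: "expands f x s a K" using real_analytic_imp_expands[OF assms(1)] by blast
  obtain t b M where g: "expands g x t b M" using real_analytic_imp_expands[OF assms(2)] by blast
  have "0 < min s t" using f g by (auto simp: expands_def)
  then have "expands f x (min s t) a K" "expands g x (min s t) b M"
    using expands_shrink[OF f] expands_shrink[OF g] by auto
  from expands_mult[OF this] show "\<exists>s a K. expands (\<lambda>x. f x * g x) x s a K" by blast
qed

lemma real_analytic_shift:
  assumes "real_analytic f"
  shows "real_analytic (\<lambda>x. f (x + v))"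
proof (rule expands_imp_real_analytic)
  fix x
  obtain s a K where "expands f (x + v) s a K" using real_analytic_imp_expands[OF assms] by blast
  then have "expands (\<lambda>x. f (x + v)) x s a K"
    unfolding expands_def by (simp add: add_ac)
  then show "\<exists>s a K. expands (\<lambda>x. f (x + v)) x s a K" by blast
qed

lemma real_analytic_exp:
  assumes "real_analytic f"
  shows "real_analytic (\<lambda>x. exp (f x))"
proof (rule real_analytic_compose[OF assms])
  fix x
  have "(\<lambda>n. (exp (f x) / fact n) * u ^ n) sums exp (f x + u)" for u
    using sums_mult[OF exp_converges[of u], of "exp (f x)"]
    by (simp add: exp_add field_simps scaleR_conv_of_real)
  then show "\<exists>\<rho>>0. \<exists>b. \<forall>u. \<bar>u\<bar> < \<rho> \<longrightarrow> (\<lambda>n. b n * u ^ n) sums exp (f x + u)"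
    by (intro exI[of _ 1] conjI exI[of _ "\<lambda>n. exp (f x) / fact n"]) auto
qed

lemma inverse_powser:
  fixes v :: real
  assumes v: "v \<noteq> 0" and u: "\<bar>u\<bar> < \<bar>v\<bar>"
  shows "(\<lambda>n. inverse v * (- inverse v) ^ n * u ^ n) sums inverse (v + u)"
proof -
  have "norm (- (u / v)) < 1" using u v by (simp add: field_simps)
  from sums_mult[OF geometric_sums[OF this], of "inverse v"]
  have "(\<lambda>n. inverse v * (- (u / v)) ^ n) sums (inverse v * (1 / (1 - - (u / v))))" .
  moreover have "inverse v * (1 / (1 - - (u / v))) = inverse (v + u)"
  proof -
    have "v + u \<noteq> 0" using u by auto
    then show ?thesis using v by (simp add: field_simps)
  qed
  moreover have "(- (u / v)) ^ n = (- inverse v) ^ n * u ^ n" for n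
    by (simp add: power_mult_distrib[symmetric] divide_inverse mult.commute)
  ultimately show ?thesis by (simp add: mult.assoc)
qed

lemma real_analytic_inverse:
  assumes "real_analytic f" and "\<And>x. f x \<noteq> 0"
  shows "real_analytic (\<lambda>x. inverse (f x))"
proof (rule real_analytic_compose[OF assms(1)])
  fix x
  show "\<exists>\<rho>>0. \<exists>b. \<forall>u. \<bar>u\<bar> < \<rho> \<longrightarrow> (\<lambda>n. b n * u ^ n) sums inverse (f x + u)"
    using assms(2)[of x] inverse_powser[of "f x"]
    by (intro exI[of _ "\<bar>f x\<bar>"] conjI exI[of _ "\<lambda>n. inverse (f x) * (- inverse (f x)) ^ n"]) auto
qed

lemma real_analytic_ln:
  assumes "real_analytic f" and "\<And>x. f x > 0"
  shows "real_analytic (\<lambda>x. ln (f x))"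
proof (rule real_analytic_compose[OF assms(1)])
  fix x
  define v where "v = f x"
  have v: "v > 0" using assms(2) by (simp add: v_def)
  define b where "b n = (if n = 0 then ln v else (-1) ^ (n - 1) / real n * inverse v ^ n)" for n
  have "(\<lambda>n. b n * u ^ n) sums ln (v + u)" if u: "\<bar>u\<bar> < v" for u
  proof -
    define z where "z = 1 + u / v"
    have z: "0 < z" "z < 2" using u v by (auto simp: z_def field_simps)
    from ln_series[OF this] have ls: "ln z = (\<Sum>n. (-1) ^ n * (1 / real (n + 1)) * (z - 1) ^ Suc n)" .
    have "\<bar>u / v\<bar> < 1" using u v by (simp add: field_simps)
    then have "summable (\<lambda>n. (-1) ^ n * (1 / real (n + 1)) * (u / v) ^ Suc n)"
    proof -
      assume a: "\<bar>u / v\<bar> < 1"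
      then have "summable (\<lambda>n. \<bar>u / v\<bar> ^ n)" by (intro summable_geometric) simp
      then have "summable (\<lambda>n. \<bar>u / v\<bar> ^ Suc n)" by (subst summable_Suc_iff)
      then show ?thesis
      proof (rule summable_comparison_test'[where N = 0])
        fix n :: nat
        have "norm ((-1) ^ n * (1 / real (n + 1)) * (u / v) ^ Suc n) = (1 / real (n + 1)) * \<bar>u / v\<bar> ^ Suc n"
          by (simp add: abs_mult power_abs)
        also have "\<dots> \<le> 1 * \<bar>u / v\<bar> ^ Suc n" by (intro mult_right_mono) auto
        finally show "norm ((-1) ^ n * (1 / real (n + 1)) * (u / v) ^ Suc n) \<le> \<bar>u / v\<bar> ^ Suc n" by simp
      qed
    qed
    then have "(\<lambda>n. (-1) ^ n * (1 / real (n + 1)) * (u / v) ^ Suc n) sums ln z"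
      using ls by (simp add: z_def summable_sums)
    moreover have "(-1) ^ n * (1 / real (n + 1)) * (u / v) ^ Suc n = b (Suc n) * u ^ Suc n" for n
      by (simp add: b_def power_divide divide_inverse power_inverse mult_ac power_mult_distrib)
    ultimately have "(\<lambda>n. b (Suc n) * u ^ Suc n) sums ln z" by simp
    then have "(\<lambda>n. b n * u ^ n) sums (ln z + b 0)" by (subst (asm) sums_Suc_iff) simp
    moreover have "ln z + b 0 = ln (v + u)"
    proof -
      have "v + u = v * z" using v by (simp add: z_def field_simps)
      then show ?thesis using v z by (simp add: b_def ln_mult)
    qed
    ultimately show ?thesis by simp
  qed
  then show "\<exists>\<rho>>0. \<exists>b. \<forall>u. \<bar>u\<bar> < \<rho> \<longrightarrow> (\<lambda>n. b n * u ^ n) sums ln (f x + u)"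
    using v unfolding v_def by blast
qed

section \<open>Characters and integration on the torus\<close>

definition mode :: "int ^ 'l::finite \<Rightarrow> real ^ 'l \<Rightarrow> complex" where
  "mode k \<theta> = cis (2 * pi * (ivec k \<bullet> \<theta>))"

lemma ivec_add: "ivec (k + j) = ivec k + ivec j"
  and ivec_minus: "ivec (- k) = - ivec k"
  by (simp_all add: ivec_def vec_eq_iff)

lemma ivec_axis: "ivec (axis i n) = axis i (of_int n)"
  by (simp add: ivec_def vec_eq_iff axis_def)

lemma mode_shift: "mode k (\<theta> + v) = mode k \<theta> * mode k v"
  by (simp add: mode_def inner_add_right cis_mult distrib_left)

lemma mode_add: "mode (k + j) \<theta> = mode k \<theta> * mode j \<theta>"
  by (simp add: mode_def ivec_add inner_add_left cis_mult distrib_left)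

lemma mode_0 [simp]: "mode 0 \<theta> = 1"
  by (simp add: mode_def ivec_def inner_vec_def)

lemma mode_minus: "mode (- k) \<theta> * mode k \<theta> = 1"
  using mode_add[of "-k" k \<theta>] by simp

lemma norm_mode [simp]: "norm (mode k \<theta>) = 1"
  by (simp add: mode_def)

lemma mode_ivec: "mode k (ivec j) = 1"
proof -
  have "ivec k \<bullet> ivec j = of_int (\<Sum>i\<in>UNIV. k $ i * j $ i)"
    by (simp add: ivec_def inner_vec_def)
  then have "mode k (ivec j) = cis (2 * pi * of_int (\<Sum>i\<in>UNIV. k $ i * j $ i))"
    by (simp add: mode_def)
  also have "\<dots> = 1" by (rule cis_multiple_2pi) (rule Ints_of_int)
  finally show ?thesis .
qed

lemma continuous_mode [continuous_intros]: "continuous_on S (mode k)"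
  unfolding mode_def by (intro continuous_intros)

lemma mode_periodic: "torus_periodic (mode k)"
  by (simp add: torus_periodic_def mode_shift mode_ivec)

lemma mode_axis: "mode (axis i n) \<theta> = cis (2 * pi * of_int n * \<theta> $ i)"
  by (simp add: mode_def ivec_axis inner_commute[of "axis i _"] inner_axis mult_ac)

abbreviation box_integral :: "(real ^ 'l::finite \<Rightarrow> complex) \<Rightarrow> complex" where
  "box_integral f \<equiv> integral (cbox 0 1) f"

lemma torus_integral_eq:
  fixes f :: "real ^ 'l::finite \<Rightarrow> 'b::euclidean_space"
  assumes "continuous_on UNIV f"
  shows "torus_integral f = integral (cbox 0 1) f"
  unfolding torus_integral_def
  by (intro set_lebesgue_integral_eq_integral(2) absolutely_integrable_continuous
        continuous_on_subset[OF assms] subset_UNIV)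

lemma content_unit_cube: "measure lborel (cbox 0 (1 :: real ^ 'l::finite)) = 1"
  by (subst content_cbox_cart) (auto simp: interval_ne_empty_cart)

text \<open>
  Shifting the unit cube by \<open>t\<close> along one axis moves a slab of thickness \<open>t\<close> from one face to the
  opposite one, where by periodicity the function takes the same values.
\<close>
lemma integral_shift_axis:
  fixes f :: "real ^ 'l::finite \<Rightarrow> complex"
  assumes cont: "continuous_on UNIV f" and per: "torus_periodic f" and t: "0 \<le> t" "t \<le> 1"
  shows "box_integral (\<lambda>\<theta>. f (\<theta> + axis i t)) = box_integral f"
proof -
  have int: "f integrable_on cbox a b" for a b
    by (intro integrable_continuous continuous_on_subset[OF cont] subset_UNIV)
  have k: "(axis i 1 :: real ^ 'l) \<in> Basis" by (simp add: axis_in_Basis_iff)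
  have [simp]: "x \<bullet> axis i 1 = x $ i" for x :: "real ^ 'l" by (simp add: inner_axis)
  have shift: "integral (cbox a b) (\<lambda>\<theta>. f (\<theta> + v)) = integral (cbox (a + v) (b + v)) f" for a b v
    using integral_shift_cbox[of "a + v" v "b + v" f] by simp
  have per1: "f (\<theta> + axis i 1) = f \<theta>" for \<theta>
    using per unfolding torus_periodic_def by (metis ivec_axis of_int_1)
  have [simp]: "axis i u $ i = u" "j \<noteq> i \<Longrightarrow> axis i u $ j = 0" for u :: real and j
    by (simp_all add: axis_def)
  have mem: "x \<in> cbox a b \<longleftrightarrow> (\<forall>j. j \<noteq> i \<longrightarrow> a $ j \<le> x $ j \<and> x $ j \<le> b $ j) \<and> a $ i \<le> x $ i \<and> x $ i \<le> b $ i"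
    for x a b :: "real ^ 'l" unfolding mem_box_cart by metis
  have "box_integral (\<lambda>\<theta>. f (\<theta> + axis i t)) = integral (cbox (axis i t) (1 + axis i t)) f"
    by (simp add: shift)
  also have "\<dots> = integral (cbox (axis i t) (1 + axis i t) \<inter> {x. x \<bullet> axis i 1 \<le> 1}) f
      + integral (cbox (axis i t) (1 + axis i t) \<inter> {x. x \<bullet> axis i 1 \<ge> 1}) f"
    by (rule integral_split[OF int k])
  also have "cbox (axis i t) (1 + axis i t) \<inter> {x. x \<bullet> axis i 1 \<le> 1} = cbox (axis i t) 1"
    using t by (auto simp: mem)
  also have "cbox (axis i t) (1 + axis i t) \<inter> {x. x \<bullet> axis i 1 \<ge> 1} = cbox (0 + axis i 1) ((1 + axis i (t - 1)) + axis i 1)"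
    using t by (auto simp: mem)
  also have "integral \<dots> f = integral (cbox 0 (1 + axis i (t - 1))) f"
    by (subst shift[symmetric]) (simp add: per1)
  also have "cbox 0 (1 + axis i (t - 1)) = cbox 0 1 \<inter> {x. x \<bullet> axis i 1 \<le> t}"
    using t by (auto simp: mem)
  also have "cbox (axis i t) 1 = cbox 0 1 \<inter> {x. x \<bullet> axis i 1 \<ge> t}"
    using t by (auto simp: mem)
  also have "integral (cbox 0 1 \<inter> {x. x \<bullet> axis i 1 \<ge> t}) f + integral (cbox 0 1 \<inter> {x. x \<bullet> axis i 1 \<le> t}) f
     = box_integral f"
    using integral_split[OF int k, of 0 1 t] by simp
  finally show ?thesis .
qed

lemma continuous_on_shift:
  fixes f :: "'a::real_normed_vector \<Rightarrow> 'b::topological_space"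
  assumes "continuous_on UNIV f"
  shows "continuous_on S (\<lambda>\<theta>. f (\<theta> + v))"
  by (rule continuous_on_compose2[OF assms]) (auto intro!: continuous_intros)

lemma torus_periodic_shift: "torus_periodic f \<Longrightarrow> torus_periodic (\<lambda>\<theta>. f (\<theta> + v))"
  by (simp add: torus_periodic_def add.assoc add.commute[of _ v]) (simp add: add.assoc[symmetric])

lemma box_integral_shift:
  fixes f :: "real ^ 'l::finite \<Rightarrow> complex"
  assumes cont: "continuous_on UNIV f" and per: "torus_periodic f"
  shows "box_integral (\<lambda>\<theta>. f (\<theta> + v)) = box_integral f"
proof -
  have step: "box_integral (\<lambda>\<theta>. f (\<theta> + (\<Sum>i\<in>S. axis i (frac (v $ i))))) = box_integral f"
    if "continuous_on UNIV f" "torus_periodic f" "finite S"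
    for S and f :: "real ^ 'l \<Rightarrow> complex"
    using that(3,1,2)
  proof (induction S arbitrary: f rule: finite_induct)
    case empty then show ?case by simp
  next
    case (insert i S)
    let ?w = "\<Sum>i\<in>S. axis i (frac (v $ i))"
    have "box_integral (\<lambda>\<theta>. f (\<theta> + (\<Sum>i\<in>insert i S. axis i (frac (v $ i)))))
        = box_integral (\<lambda>\<theta>. (\<lambda>\<theta>. f (\<theta> + ?w)) (\<theta> + axis i (frac (v $ i))))"
      using insert.hyps by (simp add: add_ac)
    also have "\<dots> = box_integral (\<lambda>\<theta>. f (\<theta> + ?w))"
      using insert.prems
      by (intro integral_shift_axis continuous_on_shift torus_periodic_shift)
        (auto simp: less_imp_le[OF frac_lt_1])
    also have "\<dots> = box_integral f" by (rule insert.IH[OF insert.prems])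
    finally show ?case .
  qed
  have v: "v = (\<Sum>i\<in>UNIV. axis i (frac (v $ i))) + ivec (\<chi> i. \<lfloor>v $ i\<rfloor>)"
    by (simp add: vec_eq_iff ivec_def axis_def frac_def if_distrib cong: if_cong)
  have "f (\<theta> + v) = f (\<theta> + (\<Sum>i\<in>UNIV. axis i (frac (v $ i))))" for \<theta>
    using per unfolding torus_periodic_def by (subst v) (simp add: add.assoc[symmetric])
  then show ?thesis using step[OF assms finite] by simp
qed

text \<open>
  For \<open>k \<noteq> 0\<close> some translation changes the sign of the character, while the integral is invariant
  under translations.
\<close>
lemma box_integral_mode:
  "box_integral (mode k) = (if k = 0 then 1 else 0)"
proof (cases "k = 0")
  case True
  have "mode (0 :: int ^ 'a) = (\<lambda>_. 1)" by auto
  then show ?thesis using True by (simp add: content_unit_cube)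
next
  case False
  then obtain i where i: "k $ i \<noteq> 0" by (auto simp: vec_eq_iff)
  \<comment> \<open>Half a period of the character in direction \<open>i\<close>.\<close>
  define v :: "real ^ 'a" where "v = axis i (1 / (2 * of_int (k $ i)))"
  have "ivec k \<bullet> v = 1 / 2" using i by (simp add: v_def inner_axis ivec_def)
  then have "mode k v = -1" unfolding mode_def by (simp only:) simp
  have "box_integral (mode k) = box_integral (\<lambda>\<theta>. mode k (\<theta> + v))"
    by (rule box_integral_shift[symmetric]) (auto intro: continuous_mode mode_periodic)
  also have "\<dots> = - box_integral (mode k)" using \<open>mode k v = -1\<close> by (simp add: mode_shift)
  finally show ?thesis using False by simp
qed

text \<open>
  Complex-valued version of the Fourier coefficient, needed because translates and Fourier series
  are handled as complex functions; \<open>fourier_coeff_eq\<close> relates it to \<open>fourier_coeff\<close>.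
\<close>
definition fcoeff :: "(real ^ 'l::finite \<Rightarrow> complex) \<Rightarrow> int ^ 'l \<Rightarrow> complex" where
  "fcoeff f k = box_integral (\<lambda>\<theta>. f \<theta> * mode (- k) \<theta>)"

lemma fourier_coeff_eq:
  assumes "continuous_on UNIV f"
  shows "fourier_coeff f k = fcoeff (\<lambda>\<theta>. of_real (f \<theta>)) k"
proof -
  have "exp (- 2 * of_real pi * \<i> * of_real (ivec k \<bullet> \<theta>)) = mode (- k) \<theta>" for \<theta>
    by (simp add: mode_def cis_conv_exp ivec_minus mult_ac)
  then show ?thesis unfolding fourier_coeff_def fcoeff_def
    by (simp, intro torus_integral_eq continuous_intros assms)
qed

lemma fcoeff_mode: "fcoeff (mode j) k = (if j = k then 1 else 0)"
proof -
  have "fcoeff (mode j) k = box_integral (mode (j - k))"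
    by (simp add: fcoeff_def flip: mode_add)
  then show ?thesis by (simp add: box_integral_mode)
qed

lemma fcoeff_shift:
  assumes "continuous_on UNIV f" "torus_periodic f"
  shows "fcoeff (\<lambda>\<theta>. f (\<theta> + v)) k = mode k v * fcoeff f k"
proof -
  have "f (\<theta> + v) * mode (- k) \<theta> = mode k v * (f (\<theta> + v) * mode (- k) (\<theta> + v))" for \<theta>
  proof -
    have "mode k v * (f (\<theta> + v) * mode (- k) (\<theta> + v)) = f (\<theta> + v) * mode (- k) \<theta> * (mode (- k) v * mode k v)"
      by (simp only: mode_shift mult_ac)
    then show ?thesis by (simp only: mode_minus mult_1_right)
  qed
  then have "fcoeff (\<lambda>\<theta>. f (\<theta> + v)) k = box_integral (\<lambda>\<theta>. mode k v * (f (\<theta> + v) * mode (- k) (\<theta> + v)))"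
    by (simp only: fcoeff_def)
  also have "\<dots> = mode k v * box_integral (\<lambda>\<theta>. f (\<theta> + v) * mode (- k) (\<theta> + v))" by simp
  also have "box_integral (\<lambda>\<theta>. f (\<theta> + v) * mode (- k) (\<theta> + v)) = fcoeff f k"
    unfolding fcoeff_def using assms mode_periodic[of "-k"]
    by (intro box_integral_shift[where f = "\<lambda>\<theta>. f \<theta> * mode (- k) \<theta>"] continuous_intros)
      (auto simp: torus_periodic_def)
  finally show ?thesis .
qed

lemma fcoeff_linear:
  assumes "continuous_on UNIV f" "continuous_on UNIV g"
  shows "fcoeff (\<lambda>\<theta>. c * f \<theta> - g \<theta>) k = c * fcoeff f k - fcoeff g k"
proof -
  have "(\<lambda>\<theta>. f \<theta> * mode (- k) \<theta>) integrable_on cbox 0 1" "(\<lambda>\<theta>. g \<theta> * mode (- k) \<theta>) integrable_on cbox 0 1"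
    by (intro integrable_continuous continuous_intros continuous_on_subset[OF assms(1)]
       continuous_on_subset[OF assms(2)] subset_UNIV)+
  then have "box_integral (\<lambda>\<theta>. c * (f \<theta> * mode (- k) \<theta>) - g \<theta> * mode (- k) \<theta>) = c * fcoeff f k - fcoeff g k"
    unfolding fcoeff_def by (subst integral_diff) (auto simp: integrable_on_mult_right)
  then show ?thesis by (simp add: fcoeff_def algebra_simps)
qed

lemma continuous_on_has_sum:
  fixes g :: "'p \<Rightarrow> 'a::topological_space \<Rightarrow> 'b::banach"
  assumes "\<And>p y. y \<in> S \<Longrightarrow> norm (g p y) \<le> M p" and "M summable_on UNIV"
    and "\<And>p. continuous_on S (g p)"
    and "\<And>y. y \<in> S \<Longrightarrow> ((\<lambda>p. g p y) has_sum G y) UNIV"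
  shows "continuous_on S G"
proof (rule uniform_limit_theorem)
  show "uniform_limit S (\<lambda>X y. \<Sum>p\<in>X. g p y) G (finite_subsets_at_top UNIV)"
    using assms by (intro Weierstrass_m_test_general') auto
  show "\<forall>\<^sub>F X in finite_subsets_at_top UNIV. continuous_on S (\<lambda>y. \<Sum>p\<in>X. g p y)"
    by (intro always_eventually allI continuous_on_sum assms)
qed simp

lemma integral_has_sum:
  fixes g :: "'p \<Rightarrow> 'a::euclidean_space \<Rightarrow> 'b::euclidean_space"
  assumes "\<And>p y. y \<in> cbox a b \<Longrightarrow> norm (g p y) \<le> M p" and "M summable_on UNIV"
    and cont: "\<And>p. continuous_on (cbox a b) (g p)"
    and "\<And>y. y \<in> cbox a b \<Longrightarrow> ((\<lambda>p. g p y) has_sum G y) UNIV"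
  shows "((\<lambda>p. integral (cbox a b) (g p)) has_sum integral (cbox a b) G) UNIV"
proof -
  have "uniform_limit (cbox a b) (\<lambda>X y. \<Sum>p\<in>X. g p y) G (finite_subsets_at_top UNIV)"
    using assms by (intro Weierstrass_m_test_general') auto
  then obtain I J where I: "\<And>X. ((\<lambda>y. \<Sum>p\<in>X. g p y) has_integral I X) (cbox a b)"
    and J: "(G has_integral J) (cbox a b)" and lim: "(I \<longlongrightarrow> J) (finite_subsets_at_top UNIV)"
    by (rule uniform_limit_integral_cbox) (auto intro!: continuous_on_sum cont)
  have "I X = (\<Sum>p\<in>X. integral (cbox a b) (g p))" if "finite X" for X
  proof -
    have "((\<lambda>y. \<Sum>p\<in>X. g p y) has_integral (\<Sum>p\<in>X. integral (cbox a b) (g p))) (cbox a b)"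
      by (intro has_integral_sum that integrable_integral integrable_continuous cont)
    with I show ?thesis by (rule has_integral_unique)
  qed
  then have "((\<lambda>X. \<Sum>p\<in>X. integral (cbox a b) (g p)) \<longlongrightarrow> J) (finite_subsets_at_top UNIV)"
    by (intro Lim_transform_eventually[OF lim] eventually_finite_subsets_at_top_weakI) auto
  then show ?thesis using J by (simp add: has_sum_def integral_unique)
qed

lemma norm_box_integral_le:
  assumes "continuous_on (cbox 0 1) f" and "\<And>\<theta>. \<theta> \<in> cbox 0 1 \<Longrightarrow> norm (f \<theta>) \<le> B" and "0 \<le> B"
  shows "norm (box_integral f) \<le> B"
  using has_integral_bound[OF assms(3) integrable_integral[OF integrable_continuous[OF assms(1)]]]
    assms(2) by (simp add: content_unit_cube)

section \<open>Fourier coefficients determine a continuous function\<close>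

text \<open>
  The trigonometric polynomial $q(\theta) = -\frac1l\sum_i \cos 2\pi\theta_i$ attains its maximum \<open>1\<close>
  over the cube only at the centre \<open>c\<close>. Adding a suitable \<open>\<epsilon>\<close> makes it larger than \<open>1\<close> near \<open>c\<close>
  while its modulus stays at most \<open>1\<close> away from \<open>c\<close>. Hence the integrals of \<open>Re g\<close> against even powers
  of \<open>q + \<epsilon>\<close> tend to infinity, although all of them vanish, because powers of a trigonometric polynomial
  are again trigonometric polynomials.
\<close>
lemma peak_contradiction:
  fixes g :: "real ^ 'l::finite \<Rightarrow> complex"
  defines "c \<equiv> (\<chi> i. 1 / 2)"
  assumes cont: "continuous_on UNIV g" and pos: "Re (g c) > 0"
    and zero: "\<And>k. box_integral (\<lambda>\<theta>. g \<theta> * mode k \<theta>) = 0"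
  shows False
proof -
  define N where "N = real CARD('l)"
  have N: "N > 0" by (simp add: N_def)
  define q where "q \<theta> = (\<Sum>i\<in>UNIV. - cos (2 * pi * \<theta> $ i)) / N" for \<theta> :: "real ^ 'l"
  have q_cont: "continuous_on S q" for S unfolding q_def by (intro continuous_intros) (use N in auto)
  have q_c: "q c = 1" by (simp add: q_def c_def N_def)
  have q_low: "q \<theta> \<ge> -1" for \<theta>
  proof -
    have "(\<Sum>i\<in>(UNIV::'l set). (-1::real)) \<le> (\<Sum>i\<in>UNIV. - cos (2 * pi * \<theta> $ i))" by (intro sum_mono) simp
    then show ?thesis using N by (simp add: q_def N_def field_simps)
  qed
  have q_less: "q \<theta> < 1" if 1: "\<theta> \<in> cbox 0 1" and 2: "\<theta> \<noteq> c" for \<theta>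
  proof -
    obtain i where i: "\<theta> $ i \<noteq> 1 / 2" using 2 by (auto simp: vec_eq_iff c_def)
    have "0 \<le> \<theta> $ i" "\<theta> $ i \<le> 1" using 1 by (auto simp: mem_box_cart)
    have "cos (2 * pi * \<theta> $ i - pi) \<noteq> 1"
    proof
      assume "cos (2 * pi * \<theta> $ i - pi) = 1"
      then obtain n :: int where "2 * pi * \<theta> $ i - pi = real_of_int n * 2 * pi" unfolding cos_one_2pi_int by blast
      then have "pi * (2 * \<theta> $ i - 1) = pi * (2 * real_of_int n)" by (simp add: algebra_simps)
      then have n: "2 * \<theta> $ i - 1 = 2 * of_int n" by simp
      then have "real_of_int n \<ge> -1/2" "real_of_int n \<le> 1/2" using \<open>0 \<le> \<theta> $ i\<close> \<open>\<theta> $ i \<le> 1\<close> by auto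
      then have "n = 0" by linarith
      with n i show False by simp
    qed
    then have "- cos (2 * pi * \<theta> $ i) \<noteq> 1" by (simp add: cos_diff)
    then have "- cos (2 * pi * \<theta> $ i) < 1" using cos_ge_minus_one[of "2 * pi * \<theta> $ i"] by linarith
    moreover have "- cos (2 * pi * \<theta> $ j) \<le> 1" for j using cos_ge_minus_one[of "2 * pi * \<theta> $ j"] by linarith
    ultimately have "(\<Sum>i\<in>UNIV. - cos (2 * pi * \<theta> $ i)) < (\<Sum>i\<in>(UNIV::'l set). 1)"
      by (intro sum_strict_mono_ex1) auto
    then show ?thesis using N by (simp add: q_def N_def)
  qed
  define h where "h \<theta> = Re (g \<theta>)" for \<theta>
  have h_cont: "continuous_on S h" for S
    unfolding h_def by (intro continuous_intros continuous_on_subset[OF cont]) auto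
  define \<eta> where "\<eta> = h c / 2"
  have \<eta>: "\<eta> > 0" using pos by (simp add: \<eta>_def h_def)
  obtain \<delta> where \<delta>: "\<delta> > 0" "\<And>\<theta>. dist \<theta> c < \<delta> \<Longrightarrow> h \<theta> > \<eta>"
  proof -
    have "isCont h c" using h_cont[of UNIV] by (simp add: continuous_on_eq_continuous_at)
    then have "\<forall>\<^sub>F \<theta> in at c. h \<theta> > \<eta>" unfolding isCont_def
      using \<eta> by (intro order_tendstoD(1)) (auto simp: \<eta>_def)
    then obtain d where "d > 0" "\<And>\<theta>. \<theta> \<noteq> c \<Longrightarrow> dist \<theta> c < d \<Longrightarrow> h \<theta> > \<eta>"
      by (auto simp: eventually_at)
    then show ?thesis using that[of d] \<eta> by (metis \<eta>_def field_sum_of_halves less_add_same_cancel1)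
  qed
  obtain m where m: "m < 1" "\<And>\<theta>. \<theta> \<in> cbox 0 1 \<Longrightarrow> dist \<theta> c \<ge> \<delta> \<Longrightarrow> q \<theta> \<le> m"
  proof (cases "cbox 0 1 - ball c \<delta> = {}")
    case True
    then show ?thesis using that[of 0] by (force simp: dist_commute)
  next
    case False
    have "compact (cbox 0 1 - ball c \<delta>)" by (intro compact_diff) auto
    from continuous_attains_sup[OF this False q_cont]
    obtain x where x: "x \<in> cbox 0 1 - ball c \<delta>" "\<And>y. y \<in> cbox 0 1 - ball c \<delta> \<Longrightarrow> q y \<le> q x" by blast
    have "q x < 1" using x \<delta>(1) by (intro q_less) auto
    then show ?thesis using that[of "q x"] x(2) by (auto simp: dist_commute)
  qed
  define \<epsilon> where "\<epsilon> = 1 - m"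
  have \<epsilon>: "\<epsilon> > 0" using m by (simp add: \<epsilon>_def)
  define Q where "Q \<theta> = q \<theta> + \<epsilon>" for \<theta>
  have Q_cont: "continuous_on S Q" for S unfolding Q_def by (intro continuous_intros q_cont)
  have Q_off: "\<bar>Q \<theta>\<bar> \<le> 1" if "\<theta> \<in> cbox 0 1" "dist \<theta> c \<ge> \<delta>" for \<theta>
    using m(2)[OF that] q_low[of \<theta>] \<epsilon> by (simp add: Q_def \<epsilon>_def abs_le_iff)
  obtain \<delta>' where \<delta>': "\<delta>' > 0" "\<And>\<theta>. dist \<theta> c < \<delta>' \<Longrightarrow> Q \<theta> > 1 + \<epsilon> / 2"
  proof -
    have "isCont Q c" using Q_cont[of UNIV] by (simp add: continuous_on_eq_continuous_at)
    moreover have Q_c: "Q c > 1 + \<epsilon> / 2" using \<epsilon> by (simp add: Q_def q_c)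
    ultimately have "\<forall>\<^sub>F \<theta> in at c. Q \<theta> > 1 + \<epsilon> / 2" unfolding isCont_def
      by (rule order_tendstoD(1))
    then obtain d where "d > 0" "\<And>\<theta>. \<theta> \<noteq> c \<Longrightarrow> dist \<theta> c < d \<Longrightarrow> Q \<theta> > 1 + \<epsilon> / 2"
      by (auto simp: eventually_at)
    then show ?thesis using that[of d] Q_c by metis
  qed
  have moments: "((\<lambda>\<theta>. g \<theta> * of_real (Q \<theta>) ^ n * mode k \<theta>) has_integral 0) (cbox 0 1)" for n k
  proof (induction n arbitrary: k)
    case 0
    have "(\<lambda>\<theta>. g \<theta> * mode k \<theta>) integrable_on cbox 0 1"
      by (intro integrable_continuous continuous_intros continuous_on_subset[OF cont]) auto
    from integrable_integral[OF this] show ?case using zero by simp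
  next
    case (Suc n)
    let ?G = "\<lambda>k \<theta>. g \<theta> * of_real (Q \<theta>) ^ n * mode k \<theta>"
    have cosm: "of_real (cos (2 * pi * \<theta> $ i)) = (mode (axis i 1) \<theta> + mode (- axis i 1) \<theta>) / 2" for \<theta> :: "real ^ 'l" and i
    proof -
      have "- axis i 1 = (axis i (-1) :: int ^ 'l)" by (simp add: vec_eq_iff axis_def)
      then show ?thesis by (simp add: mode_axis complex_eq_iff)
    qed
    have "((\<lambda>\<theta>. of_real \<epsilon> * ?G k \<theta> +
        (\<Sum>i\<in>UNIV. of_real (- 1 / (2 * N)) * (?G (k + axis i 1) \<theta> + ?G (k + - axis i 1) \<theta>)))
      has_integral (of_real \<epsilon> * 0 + (\<Sum>i\<in>(UNIV::'l set). of_real (- 1 / (2 * N)) * (0 + 0)))) (cbox 0 1)"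
      by (intro has_integral_add has_integral_sum has_integral_mult_right Suc.IH finite)
    also have "(\<lambda>\<theta>. of_real \<epsilon> * ?G k \<theta> +
        (\<Sum>i\<in>UNIV. of_real (- 1 / (2 * N)) * (?G (k + axis i 1) \<theta> + ?G (k + - axis i 1) \<theta>)))
      = (\<lambda>\<theta>. g \<theta> * of_real (Q \<theta>) ^ Suc n * mode k \<theta>)"
    proof
      fix \<theta>
      have "(\<Sum>i\<in>UNIV. of_real (- 1 / (2 * N)) * (?G (k + axis i 1) \<theta> + ?G (k + - axis i 1) \<theta>))
          = (\<Sum>i\<in>UNIV. ?G k \<theta> * of_real (- cos (2 * pi * \<theta> $ i) / N))"
        by (intro sum.cong refl, simp only: of_real_divide of_real_minus cosm mode_add) (simp add: field_simps)
      also have "\<dots> = ?G k \<theta> * of_real (q \<theta>)"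
        by (simp add: q_def sum_distrib_left sum_divide_distrib)
      finally have eq: "(\<Sum>i\<in>UNIV. of_real (- 1 / (2 * N)) * (?G (k + axis i 1) \<theta> + ?G (k + - axis i 1) \<theta>))
        = ?G k \<theta> * of_real (q \<theta>)" .
      show "of_real \<epsilon> * ?G k \<theta> +
        (\<Sum>i\<in>UNIV. of_real (- 1 / (2 * N)) * (?G (k + axis i 1) \<theta> + ?G (k + - axis i 1) \<theta>))
        = g \<theta> * of_real (Q \<theta>) ^ Suc n * mode k \<theta>"
        unfolding eq by (simp add: Q_def algebra_simps)
    qed
    finally show ?case by simp
  qed
  have hQ: "((\<lambda>\<theta>. h \<theta> * Q \<theta> ^ n) has_integral 0) (cbox 0 1)" for n
  proof -
    have "((\<lambda>\<theta>. Re (g \<theta> * of_real (Q \<theta>) ^ n * mode 0 \<theta>)) has_integral Re 0) (cbox 0 1)"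
      using has_integral_linear[OF moments[of n 0] bounded_linear_Re] by (simp add: o_def)
    then show ?thesis by (simp add: h_def flip: of_real_power)
  qed
  obtain H where H: "\<And>\<theta>. \<theta> \<in> cbox 0 1 \<Longrightarrow> \<bar>h \<theta>\<bar> \<le> H" "H \<ge> 0"
  proof -
    have "bounded (h ` cbox 0 1)" by (intro compact_imp_bounded compact_continuous_image h_cont compact_cbox)
    then obtain B where "\<forall>x\<in>h ` cbox 0 1. norm x \<le> B" unfolding bounded_iff by blast
    then have "\<And>\<theta>. \<theta> \<in> cbox 0 1 \<Longrightarrow> \<bar>h \<theta>\<bar> \<le> max B 0" by auto
    then show ?thesis using that by fastforce
  qed
  \<comment> \<open>A cube around the centre on which both \<open>h\<close> and \<open>Q\<close> are large.\<close>
  define r where "r = min (1/2) (min \<delta> \<delta>' / (N + 1))"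
  have r: "0 < r" "r \<le> 1/2" "N * r < min \<delta> \<delta>'"
  proof -
    show "0 < r" using \<delta> \<delta>' N by (auto simp: r_def)
    show "r \<le> 1/2" unfolding r_def by (rule min.cobounded1)
    have "N * r \<le> N * (min \<delta> \<delta>' / (N + 1))" using N by (intro mult_left_mono) (auto simp: r_def)
    also have "\<dots> < min \<delta> \<delta>'"
    proof -
      have aux: "N * (u / (N + 1)) < u" if "u > 0" for u using that N by (simp add: field_simps)
      have "min \<delta> \<delta>' > 0" using \<delta>(1) \<delta>'(1) by simp
      from aux[OF this] show ?thesis .
    qed
    finally show "N * r < min \<delta> \<delta>'" .
  qed
  define B where "B = cbox (c - (\<chi> i. r)) (c + (\<chi> i. r))"
  have B_sub: "B \<subseteq> cbox 0 1" using r by (auto simp: B_def mem_box_cart c_def) (smt (verit) field_sum_of_halves)+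
  have B_ball: "dist \<theta> c < min \<delta> \<delta>'" if "\<theta> \<in> B" for \<theta>
  proof -
    have *: "\<bar>(\<theta> - c) $ i\<bar> \<le> r" for i using that by (auto simp: B_def mem_box_cart abs_le_iff) (smt (verit))+
    have "norm (\<theta> - c) \<le> (\<Sum>i\<in>UNIV. \<bar>(\<theta> - c) $ i\<bar>)" by (rule norm_le_l1_cart)
    also have "\<dots> \<le> (\<Sum>i\<in>(UNIV::'l set). r)" by (intro sum_mono *)
    also have "\<dots> < min \<delta> \<delta>'" using r(3) by (simp add: N_def)
    finally show ?thesis by (simp add: dist_norm)
  qed
  define V where "V = measure lborel B"
  have V: "V > 0" unfolding V_def B_def
    using r by (subst content_cbox_cart) (auto simp: interval_ne_empty_cart)
  define y where "y = (1 + \<epsilon> / 2) ^ 2"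
  have y: "y > 1" using \<epsilon> by (simp add: y_def)
  obtain j where j: "H / (\<eta> * V) < y ^ j" using real_arch_pow[OF y] by blast
  define C where "C = \<eta> * y ^ j"
  have C: "C \<ge> 0" using \<eta> y by (simp add: C_def)
  have "((\<lambda>\<theta>. if \<theta> \<in> B then C else 0) has_integral V * C) (cbox 0 1)"
    using has_integral_const[of C "c - (\<chi> i. r)" "c + (\<chi> i. r)"]
    by (subst has_integral_restrict[OF B_sub]) (simp add: B_def V_def)
  moreover have "((\<lambda>\<theta>. - H) has_integral - H) (cbox 0 (1 :: real ^ 'l))"
    using has_integral_const[of "-H" 0 "1 :: real ^ 'l"] by (simp add: content_unit_cube)
  ultimately have I: "((\<lambda>\<theta>. (if \<theta> \<in> B then C else 0) + - H) has_integral V * C + - H) (cbox 0 1)"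
    by (rule has_integral_add)
  have "V * C + - H \<le> 0"
  proof (rule has_integral_le[OF I hQ[of "2 * j"]])
    fix \<theta> :: "real ^ 'l" assume \<theta>: "\<theta> \<in> cbox 0 1"
    have nn: "Q \<theta> ^ (2 * j) \<ge> 0" by (simp add: power_mult)
    show "(if \<theta> \<in> B then C else 0) + - H \<le> h \<theta> * Q \<theta> ^ (2 * j)"
    proof (cases "dist \<theta> c < \<delta>")
      case False
      then have "\<theta> \<notin> B" using B_ball by fastforce
      have "\<bar>Q \<theta> ^ (2 * j)\<bar> \<le> 1" using Q_off[OF \<theta>] False by (simp add: power_abs power_le_one)
      then have "\<bar>h \<theta> * Q \<theta> ^ (2 * j)\<bar> \<le> H * 1" unfolding abs_mult using H \<theta> by (intro mult_mono) auto
      then show ?thesis using \<open>\<theta> \<notin> B\<close> by (simp add: abs_le_iff)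
    next
      case True
      have hp: "h \<theta> > \<eta>" using \<delta>(2)[OF True] .
      show ?thesis
      proof (cases "\<theta> \<in> B")
        case True
        then have "Q \<theta> > 1 + \<epsilon> / 2" using B_ball[OF True] \<delta>'(2) by simp
        then have "(1 + \<epsilon> / 2) ^ (2 * j) \<le> Q \<theta> ^ (2 * j)" using \<epsilon> by (intro power_mono) auto
        then have "\<eta> * y ^ j \<le> h \<theta> * Q \<theta> ^ (2 * j)" using hp \<eta> y
          by (intro mult_mono) (auto simp: y_def power_mult)
        then show ?thesis using True H(2) by (simp add: C_def)
      next
        case False
        have "0 \<le> h \<theta> * Q \<theta> ^ (2 * j)" using hp \<eta> nn by simp
        then show ?thesis using False H(2) by simp
      qed
    qed
  qed
  moreover have "V * C > H" using j \<eta> V by (simp add: C_def field_simps)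
  ultimately show False by simp
qed

text \<open>
  Translating the point to the centre of the cube and multiplying by the conjugate of the value there
  reduces the claim to \<open>peak_contradiction\<close>.
\<close>
lemma fcoeff_zero_imp_zero:
  assumes cont: "continuous_on UNIV f" and per: "torus_periodic f" and zero: "\<And>k. fcoeff f k = 0"
  shows "f x = 0"
proof (rule ccontr)
  assume nz: "f x \<noteq> 0"
  define v where "v = x - (\<chi> i. 1 / 2)"
  define g where "g \<theta> = cnj (f x) * f (\<theta> + v)" for \<theta>
  show False
  proof (rule peak_contradiction[of g])
    show "continuous_on UNIV g" unfolding g_def by (intro continuous_intros continuous_on_shift cont)
    have "g (\<chi> i. 1 / 2) = f x * cnj (f x)" by (simp add: g_def v_def)
    also have "\<dots> = of_real ((cmod (f x))\<^sup>2)" by (simp only: complex_norm_square)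
    finally have "g (\<chi> i. 1 / 2) = of_real ((cmod (f x))\<^sup>2)" .
    then show "Re (g (\<chi> i. 1 / 2)) > 0" using nz by simp
    show "box_integral (\<lambda>\<theta>. g \<theta> * mode k \<theta>) = 0" for k
      using fcoeff_shift[OF cont per, of v "-k"] zero[of "-k"]
      by (simp add: g_def fcoeff_def mult.assoc)
  qed
qed

section \<open>Exponential decay of Fourier coefficients\<close>

lemma mdeg_split: "mdeg \<alpha> = \<alpha> i + (\<Sum>j\<in>UNIV - {i}. \<alpha> j)"
  by (rule sum.remove) auto

text \<open>
  Re-expansion of the series at a nearby point in the single direction \<open>i\<close>, by the binomial
  theorem. Halving the radius leaves room for the shift: $|h_i| + |t| \le s$, so the double series over
  multi-indices and powers of \<open>t\<close> is dominated by the original one, and \<open>K\<close> still bounds the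
  coefficients.
\<close>
lemma expands_along_axis:
  fixes f :: "real ^ 'l::finite \<Rightarrow> real"
  assumes e: "expands f x s a K" and h: "\<And>j. \<bar>h $ j\<bar> \<le> s / 2"
  shows "\<exists>c. (\<forall>m. \<bar>c m\<bar> * (s / 2) ^ m \<le> K) \<and>
     (\<forall>t. \<bar>t\<bar> \<le> s / 2 \<longrightarrow> ((\<lambda>m. c m * t ^ m) has_sum f (x + h + axis i t)) UNIV)"
proof -
  have s: "s > 0" and A: "(\<lambda>\<alpha>. \<bar>a \<alpha>\<bar> * s ^ mdeg \<alpha>) summable_on UNIV"
    and AK: "(\<Sum>\<^sub>\<infinity>\<alpha>. \<bar>a \<alpha>\<bar> * s ^ mdeg \<alpha>) \<le> K"
    and ex: "\<And>h. (\<And>i. \<bar>h $ i\<bar> \<le> s) \<Longrightarrow> ((\<lambda>\<alpha>. a \<alpha> * monomial h \<alpha>) has_sum f (x + h)) UNIV"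
    using e unfolding expands_def by auto
  define R where "R \<alpha> = a \<alpha> * (\<Prod>j\<in>UNIV - {i}. (h $ j) ^ \<alpha> j)" for \<alpha>
  define w where "w \<alpha> m = R \<alpha> * (of_nat (\<alpha> i choose m) * (h $ i) ^ (\<alpha> i - m))" for \<alpha> m
  have R_bound: "\<bar>R \<alpha>\<bar> \<le> \<bar>a \<alpha>\<bar> * s ^ (\<Sum>j\<in>UNIV - {i}. \<alpha> j)" for \<alpha>
  proof -
    have "\<bar>h $ j\<bar> \<le> s" for j using h[of j] s by simp
    then have "(\<Prod>j\<in>UNIV - {i}. \<bar>h $ j\<bar> ^ \<alpha> j) \<le> (\<Prod>j\<in>UNIV - {i}. s ^ \<alpha> j)"
      by (intro prod_mono conjI power_mono) auto
    then show ?thesis by (simp add: R_def abs_mult abs_prod power_abs power_sum mult_left_mono)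
  qed
  have binom: "((\<lambda>m. real (n choose m) * u ^ (n - m) * t ^ m) has_sum (t + u) ^ n) UNIV" for n and t u :: real
    unfolding binomial_ring
    by (rule has_sum_finite_neutralI[where B = "{..n}"]) (auto simp: mult_ac)
  have w_sum: "((\<lambda>m. w \<alpha> m * t ^ m) has_sum R \<alpha> * (t + h $ i) ^ \<alpha> i) UNIV" for \<alpha> t
    using has_sum_cmult_right[OF binom, of "R \<alpha>" "\<alpha> i" "h $ i" t] by (simp add: w_def mult_ac)
  have w_abs_sum: "((\<lambda>m. \<bar>w \<alpha> m * t ^ m\<bar>) has_sum \<bar>R \<alpha>\<bar> * (\<bar>t\<bar> + \<bar>h $ i\<bar>) ^ \<alpha> i) UNIV" for \<alpha> t
    using has_sum_cmult_right[OF binom, of "\<bar>R \<alpha>\<bar>" "\<alpha> i" "\<bar>h $ i\<bar>" "\<bar>t\<bar>"]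
    by (simp add: w_def abs_mult power_abs mult_ac)
  have w_tot: "\<bar>R \<alpha>\<bar> * (\<bar>t\<bar> + \<bar>h $ i\<bar>) ^ \<alpha> i \<le> \<bar>a \<alpha>\<bar> * s ^ mdeg \<alpha>" if t: "\<bar>t\<bar> \<le> s / 2" for \<alpha> t
  proof -
    have "(\<bar>t\<bar> + \<bar>h $ i\<bar>) ^ \<alpha> i \<le> s ^ \<alpha> i" using t h[of i] by (intro power_mono) auto
    then have "\<bar>R \<alpha>\<bar> * (\<bar>t\<bar> + \<bar>h $ i\<bar>) ^ \<alpha> i \<le> (\<bar>a \<alpha>\<bar> * s ^ (\<Sum>j\<in>UNIV - {i}. \<alpha> j)) * s ^ \<alpha> i"
      using s by (intro mult_mono R_bound) auto
    then show ?thesis by (simp add: mdeg_split[of \<alpha> i] power_add mult_ac)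
  qed
  have w_term: "\<bar>w \<alpha> m * t ^ m\<bar> \<le> \<bar>a \<alpha>\<bar> * s ^ mdeg \<alpha>" if t: "\<bar>t\<bar> \<le> s / 2" for \<alpha> m t
    using finite_sum_le_has_sum[OF w_abs_sum, of "{m}" \<alpha> t] w_tot[OF t, of \<alpha>] by simp
  have w_summable: "(\<lambda>\<alpha>. w \<alpha> m) summable_on UNIV" for m
  proof -
    have "(\<lambda>\<alpha>. norm (w \<alpha> m * (s / 2) ^ m)) summable_on UNIV"
      by (rule Infinite_Sum.abs_summable_on_comparison_test'[OF A]) (use w_term[of "s / 2"] s in auto)
    then have "(\<lambda>\<alpha>. w \<alpha> m * (s / 2) ^ m) summable_on UNIV" by (rule abs_summable_summable)
    then show ?thesis using s by (simp add: summable_on_cmult_left')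
  qed
  define c where "c m = (\<Sum>\<^sub>\<infinity>\<alpha>. w \<alpha> m)" for m
  have c_sum: "((\<lambda>\<alpha>. w \<alpha> m * t ^ m) has_sum c m * t ^ m) UNIV" for m t
    unfolding c_def by (intro has_sum_cmult_left has_sum_infsum w_summable)
  have c1: "\<bar>c m\<bar> * (s / 2) ^ m \<le> K" for m
  proof -
    have "norm (c m * (s / 2) ^ m) \<le> (\<Sum>\<^sub>\<infinity>\<alpha>. \<bar>a \<alpha>\<bar> * s ^ mdeg \<alpha>)"
      by (rule norm_infsum_le[OF c_sum has_sum_infsum[OF A]]) (use w_term[of "s / 2"] s in auto)
    then show ?thesis using AK s by (simp add: abs_mult)
  qed
  have c2: "((\<lambda>m. c m * t ^ m) has_sum f (x + h + axis i t)) UNIV" if t: "\<bar>t\<bar> \<le> s / 2" for t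
  proof -
    let ?v = "\<lambda>z. w (fst z) (snd z) * t ^ snd z"
    have mon: "monomial (h + axis i t) \<alpha> = (\<Prod>j\<in>UNIV - {i}. (h $ j) ^ \<alpha> j) * (t + h $ i) ^ \<alpha> i" for \<alpha>
    proof -
      have "(\<Prod>j\<in>UNIV - {i}. ((h + axis i t) $ j) ^ \<alpha> j) = (\<Prod>j\<in>UNIV - {i}. (h $ j) ^ \<alpha> j)"
        by (rule prod.cong) (auto simp: axis_def)
      then show ?thesis unfolding monomial_def
        by (subst prod.remove[of _ i]) (auto simp: axis_def add.commute)
    qed
    have "\<bar>(h + axis i t) $ j\<bar> \<le> s" for j
      using h[of j] t s by (auto simp: axis_def)
    from ex[OF this] have total: "((\<lambda>\<alpha>. R \<alpha> * (t + h $ i) ^ \<alpha> i) has_sum f (x + h + axis i t)) UNIV"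
      by (simp add: mon R_def mult_ac add_ac)
    have "(\<lambda>z. \<bar>?v z\<bar>) summable_on UNIV \<times> UNIV"
    proof (rule summable_on_SigmaI)
      show "((\<lambda>m. \<bar>?v (\<alpha>, m)\<bar>) has_sum \<bar>R \<alpha>\<bar> * (\<bar>t\<bar> + \<bar>h $ i\<bar>) ^ \<alpha> i) UNIV" for \<alpha>
        using w_abs_sum by simp
      show "(\<lambda>\<alpha>. \<bar>R \<alpha>\<bar> * (\<bar>t\<bar> + \<bar>h $ i\<bar>) ^ \<alpha> i) summable_on UNIV"
        by (rule summable_on_comparison_test[OF A w_tot[OF t]]) auto
    qed auto
    then have sm: "?v summable_on UNIV \<times> UNIV" by (intro abs_summable_summable[of ?v]) simp
    have "((\<lambda>m. ?v (\<alpha>, m)) has_sum R \<alpha> * (t + h $ i) ^ \<alpha> i) UNIV" for \<alpha> using w_sum by simp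
    from has_sum_SigmaI[OF this total sm]
    have 1: "(?v has_sum f (x + h + axis i t)) (UNIV \<times> UNIV)" by simp
    have "bij_betw prod.swap (UNIV \<times> UNIV :: (nat \<times> ('l \<Rightarrow> nat)) set) (UNIV \<times> UNIV)"
      by (simp add: bij_betw_def)
    from has_sum_reindex_bij_betw[OF this, of ?v] 1
    have 2: "((\<lambda>z. ?v (prod.swap z)) has_sum f (x + h + axis i t)) (UNIV \<times> UNIV)" by simp
    show ?thesis
      by (rule has_sum_SigmaD[OF 2]) (use c_sum in simp)
  qed
  show ?thesis by (intro exI[of _ c] conjI allI impI c1 c2)
qed

lemma uniform_axis_expansion:
  fixes f :: "real ^ 'l::finite \<Rightarrow> real"
  assumes f: "real_analytic f" and S: "compact S"
  shows "\<exists>r>0. \<exists>M\<ge>0. \<forall>\<theta>\<in>S. \<forall>i. \<exists>c. (\<forall>m. \<bar>c m\<bar> * r ^ m \<le> M) \<and>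
     (\<forall>t. \<bar>t\<bar> \<le> r \<longrightarrow> ((\<lambda>m. c m * t ^ m) has_sum f (\<theta> + axis i t)) UNIV)"
proof -
  obtain s a K where e: "\<And>x. expands f x (s x) (a x) (K x)"
    using real_analytic_imp_expands[OF f] by metis
  have s: "s x > 0" and K: "K x \<ge> 0" for x
    using e[of x] expands_nonneg[OF e] by (auto simp: expands_def)
  have cover: "S \<subseteq> (\<Union>x\<in>S. ball x (s x / 2))" using s by force
  obtain D where D: "D \<subseteq> S" "finite D" "S \<subseteq> (\<Union>x\<in>D. ball x (s x / 2))"
    by (rule compactE_image[OF S _ cover]) auto
  define r where "r = Min (insert 1 ((\<lambda>x. s x / 2) ` D))"
  define M where "M = (\<Sum>x\<in>D. K x)"
  have r: "r > 0" unfolding r_def using D s by (subst Min_gr_iff) auto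
  have M: "M \<ge> 0" unfolding M_def by (intro sum_nonneg K)
  have "\<exists>c. (\<forall>m. \<bar>c m\<bar> * r ^ m \<le> M) \<and>
     (\<forall>t. \<bar>t\<bar> \<le> r \<longrightarrow> ((\<lambda>m. c m * t ^ m) has_sum f (\<theta> + axis i t)) UNIV)" if \<theta>: "\<theta> \<in> S" for \<theta> i
  proof -
    obtain x where x: "x \<in> D" "dist x \<theta> < s x / 2"
      using subsetD[OF D(3) \<theta>] by (auto simp only: mem_ball UN_iff)
    have h: "\<bar>(\<theta> - x) $ j\<bar> \<le> s x / 2" for j
      using component_le_norm_cart[of "\<theta> - x" j] x(2) by (simp add: dist_norm norm_minus_commute)
    have rs: "r \<le> s x / 2" unfolding r_def using x D by (intro Min_le) auto
    have KM: "K x \<le> M" unfolding M_def using x D K by (intro member_le_sum) auto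
    obtain c where c: "\<And>m. \<bar>c m\<bar> * (s x / 2) ^ m \<le> K x"
       "\<And>t. \<bar>t\<bar> \<le> s x / 2 \<Longrightarrow> ((\<lambda>m. c m * t ^ m) has_sum f (\<theta> + axis i t)) UNIV"
      using expands_along_axis[OF e h, of i] by auto
    have "\<bar>c m\<bar> * r ^ m \<le> M" for m
    proof -
      have "\<bar>c m\<bar> * r ^ m \<le> \<bar>c m\<bar> * (s x / 2) ^ m" using r rs by (intro mult_left_mono power_mono) auto
      then show ?thesis using c(1)[of m] KM by linarith
    qed
    then show ?thesis using c(2) rs by (meson order_trans)
  qed
  then show ?thesis using r M by blast
qed

text \<open>
  The next coefficient of a power series is the limit of the normalised remainders, with a rate that
  depends only on the geometric bound. This is used both for functions depending on a parameter, where
  the rate gives uniformity, and for comparing coefficients of two series.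
\<close>
lemma powser_remainder:
  fixes c :: "nat \<Rightarrow> 'a::{real_normed_field, banach}"
  assumes c: "\<And>j. norm (c j) * r ^ j \<le> M" and t: "0 < t" "t < r"
    and S: "(\<lambda>j. c j * of_real t ^ j) sums S"
  shows "norm ((S - (\<Sum>j<m. c j * of_real t ^ j)) / of_real t ^ m - c m) \<le> M / r ^ m * ((t / r) / (1 - t / r))"
proof -
  let ?x = "t / r"
  have x: "0 < ?x" "?x < 1" using t by auto
  have A: "(\<lambda>j. c (j + Suc m) * of_real t ^ (j + Suc m)) sums (S - (\<Sum>j<Suc m. c j * of_real t ^ j))"
    by (rule sums_split_initial_segment[OF S])
  have B: "(\<lambda>j. M * ?x ^ Suc m * ?x ^ j) sums (M * ?x ^ Suc m * (1 / (1 - ?x)))"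
    using x by (intro sums_mult geometric_sums) auto
  have le: "norm (c (j + Suc m) * of_real t ^ (j + Suc m)) \<le> M * ?x ^ Suc m * ?x ^ j" for j
  proof -
    have "norm (c (j + Suc m) * of_real t ^ (j + Suc m)) = norm (c (j + Suc m)) * r ^ (j + Suc m) * ?x ^ (j + Suc m)"
      using t by (simp add: norm_mult norm_power power_divide)
    also have "\<dots> \<le> M * ?x ^ (j + Suc m)" using x by (intro mult_right_mono c zero_le_power) auto
    finally show ?thesis by (simp add: power_add mult_ac)
  qed
  have bd: "norm (S - (\<Sum>j<Suc m. c j * of_real t ^ j)) \<le> M * ?x ^ Suc m * (1 / (1 - ?x))"
    using norm_suminf_le[OF le sums_summable[OF B]] by (simp only: sums_unique[OF A] sums_unique[OF B])
  have "(S - (\<Sum>j<m. c j * of_real t ^ j)) / of_real t ^ m - c m = (S - (\<Sum>j<Suc m. c j * of_real t ^ j)) / of_real t ^ m"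
    using t by (simp add: field_simps)
  then have "norm ((S - (\<Sum>j<m. c j * of_real t ^ j)) / of_real t ^ m - c m) = norm (S - (\<Sum>j<Suc m. c j * of_real t ^ j)) / t ^ m"
    using t by (simp only: norm_divide norm_power norm_of_real abs_of_pos)
  also have "\<dots> \<le> M * ?x ^ Suc m * (1 / (1 - ?x)) / t ^ m"
    using bd t by (intro divide_right_mono) auto
  also have "\<dots> = M / r ^ m * (?x / (1 - ?x))"
    using t by (simp add: power_divide)
  finally show ?thesis .
qed

lemma remainder_sequence:
  assumes "r > 0"
  defines "t \<equiv> \<lambda>n. r / (real n + 2)"
  shows "0 < t n" "t n < r" "(t n / r) / (1 - t n / r) = inverse (real (Suc n))"
proof -
  show "0 < t n" "t n < r" using assms by (auto simp: t_def field_simps intro: add_pos_nonneg)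
  have "t n / r = 1 / (real n + 2)" using assms by (simp add: t_def)
  moreover have "1 - 1 / (real n + 2) = (real n + 1) / (real n + 2)" by (simp add: field_simps)
  ultimately show "(t n / r) / (1 - t n / r) = inverse (real (Suc n))" by (simp add: inverse_eq_divide)
qed

lemma powser_zero_coeffs:
  fixes c :: "nat \<Rightarrow> 'a::{real_normed_field, banach}"
  assumes r: "r > 0" and c: "\<And>j. norm (c j) * r ^ j \<le> M"
    and S: "\<And>t. 0 < t \<Longrightarrow> t < r \<Longrightarrow> (\<lambda>j. c j * of_real t ^ j) sums 0"
  shows "c m = 0"
proof (induction m rule: less_induct)
  case (less m)
  have "norm (c m) \<le> M / r ^ m * (inverse (real (Suc n)))" for n
    using powser_remainder[OF c remainder_sequence(1,2)[OF r, of n] S[OF remainder_sequence(1,2)[OF r, of n]], of m]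
    unfolding remainder_sequence(3)[OF r] using less.IH by simp
  moreover have "(\<lambda>n. M / r ^ m * (inverse (real (Suc n)))) \<longlonglongrightarrow> 0"
    by (rule tendsto_mult_right_zero[OF LIMSEQ_inverse_real_of_nat])
  ultimately have "norm (c m) \<le> 0"
    by (intro LIMSEQ_le_const) auto
  then show ?case by simp
qed

text \<open>
  The normalised remainders are continuous by induction on \<open>m\<close> and converge uniformly in the
  base point. Continuity is what allows the coefficients to be integrated over the torus.
\<close>
lemma continuous_axis_coeffs:
  fixes f :: "real ^ 'l::finite \<Rightarrow> real"
  assumes f: "continuous_on UNIV f" and r: "r > 0"
    and c: "\<And>\<theta> m. \<theta> \<in> S \<Longrightarrow> \<bar>c \<theta> m\<bar> * r ^ m \<le> M"
    and s: "\<And>\<theta> t. \<theta> \<in> S \<Longrightarrow> \<bar>t\<bar> \<le> r \<Longrightarrow> ((\<lambda>m. c \<theta> m * t ^ m) has_sum f (\<theta> + axis i t)) UNIV"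
  shows "continuous_on S (\<lambda>\<theta>. c \<theta> m)"
proof (induction m rule: less_induct)
  case (less m)
  define t where "t n = r / (real n + 2)" for n
  note t = remainder_sequence[OF r, folded t_def]
  define g where "g n \<theta> = (f (\<theta> + axis i (t n)) - (\<Sum>j<m. c \<theta> j * t n ^ j)) / t n ^ m" for n \<theta>
  have lim: "uniform_limit S g (\<lambda>\<theta>. c \<theta> m) sequentially"
  proof (rule uniform_limitI)
    fix e :: real assume e: "e > 0"
    have "(\<lambda>n. M / r ^ m * (inverse (real (Suc n)))) \<longlonglongrightarrow> 0" by (rule tendsto_mult_right_zero[OF LIMSEQ_inverse_real_of_nat])
    then have "\<forall>\<^sub>F n in sequentially. M / r ^ m * (inverse (real (Suc n))) < e"
      using e by (rule order_tendstoD(2))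
    then show "\<forall>\<^sub>F n in sequentially. \<forall>\<theta>\<in>S. dist (g n \<theta>) (c \<theta> m) < e"
    proof (rule eventually_mono, intro ballI)
      fix n \<theta> assume lt: "M / r ^ m * (inverse (real (Suc n))) < e" and \<theta>: "\<theta> \<in> S"
      have "\<bar>t n\<bar> \<le> r" using t(1,2)[of n] by simp
      from has_sum_imp_sums[OF s[OF \<theta> this]]
      have "norm ((f (\<theta> + axis i (t n)) - (\<Sum>j<m. c \<theta> j * of_real (t n) ^ j)) / of_real (t n) ^ m - c \<theta> m)
          \<le> M / r ^ m * ((t n / r) / (1 - t n / r))"
        by (intro powser_remainder t) (use c[OF \<theta>] in auto)
      then have "norm (g n \<theta> - c \<theta> m) \<le> M / r ^ m * inverse (real (Suc n))"
        unfolding t(3) by (simp add: g_def)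
      then show "dist (g n \<theta>) (c \<theta> m) < e" using lt unfolding dist_norm by (rule le_less_trans)
    qed
  qed
  have "continuous_on S (g n)" for n
    unfolding g_def using t(1)[of n] less.IH
    by (intro continuous_intros continuous_on_shift f) auto
  then show ?case by (intro uniform_limit_theorem[OF _ lim]) auto
qed

lemma real_analytic_continuous:
  fixes f :: "real ^ 'l::finite \<Rightarrow> real"
  assumes "real_analytic f"
  shows "continuous_on S f"
proof -
  have "isCont f x" for x
  proof -
    obtain s a K where e: "expands f x s a K" using real_analytic_imp_expands[OF assms] by blast
    have A: "(\<lambda>\<alpha>. \<bar>a \<alpha>\<bar> * s ^ mdeg \<alpha>) summable_on UNIV" and s: "s > 0"
      and ex: "\<And>h. (\<And>i. \<bar>h $ i\<bar> \<le> s) \<Longrightarrow> ((\<lambda>\<alpha>. a \<alpha> * monomial h \<alpha>) has_sum f (x + h)) UNIV"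
      using e unfolding expands_def by auto
    have small: "\<bar>(y - x) $ i\<bar> \<le> s" if "y \<in> ball x s" for y i
      using component_le_norm_cart[of "y - x" i] that by (simp add: dist_norm norm_minus_commute)
    have "continuous_on (ball x s) f"
    proof (rule continuous_on_has_sum[OF _ A])
      show "norm (a \<alpha> * monomial (y - x) \<alpha>) \<le> \<bar>a \<alpha>\<bar> * s ^ mdeg \<alpha>" if "y \<in> ball x s" for y \<alpha>
        using monomial_bound[OF small[OF that]] by (simp add: abs_mult mult_left_mono)
      show "continuous_on (ball x s) (\<lambda>y. a \<alpha> * monomial (y - x) \<alpha>)" for \<alpha>
        unfolding monomial_def by (intro continuous_intros)
      show "((\<lambda>\<alpha>. a \<alpha> * monomial (y - x) \<alpha>) has_sum f y) UNIV" if "y \<in> ball x s" for y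
        using ex[OF small[OF that]] by simp
    qed
    then show ?thesis using s by (simp add: continuous_on_eq_continuous_at)
  qed
  then show ?thesis by (auto intro: continuous_at_imp_continuous_on)
qed

text \<open>
  The translate of \<open>f\<close> by \<open>t\<close> along the \<open>i\<close>-th axis has \<open>k\<close>-th coefficient
  $e^{2\pi i k_i t}\hat f_k$. Expanding the translate in powers of \<open>t\<close> and integrating termwise gives
  a power series for this function of \<open>t\<close> with coefficients bounded by $M r^{-m}$; the exponential
  series gives a second one. Equality of the coefficients bounds $(2\pi|k_i|)^m|\hat f_k|/m!$ by $M r^{-m}$; multiplying by $(r/2)^m$ and summing
  yields the exponential factor.
\<close>
lemma fcoeff_axis_decay:
  fixes f :: "real ^ 'l::finite \<Rightarrow> real"
  assumes f: "torus_analytic f"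
  shows "\<exists>\<delta>>0. \<exists>M\<ge>0. \<forall>k i. exp (\<delta> * \<bar>of_int (k $ i)\<bar>) * norm (fcoeff (\<lambda>\<theta>. of_real (f \<theta>)) k) \<le> M"
proof -
  let ?f = "\<lambda>\<theta>. complex_of_real (f \<theta>)"
  have an: "real_analytic f" and per: "torus_periodic f" using f by (auto simp: torus_analytic_def)
  have fc: "continuous_on S f" for S by (rule real_analytic_continuous[OF an])
  have cf: "continuous_on S ?f" for S by (intro continuous_intros fc)
  have pf: "torus_periodic ?f" using per by (simp add: torus_periodic_def)
  define P where "P r M \<theta> i c \<longleftrightarrow> (\<forall>m. \<bar>c m\<bar> * r ^ m \<le> M) \<and>
     (\<forall>t. \<bar>t\<bar> \<le> r \<longrightarrow> ((\<lambda>m. c m * t ^ m) has_sum f (\<theta> + axis i t)) UNIV)" for r M \<theta> i c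
  obtain r M where r: "r > 0" and M: "M \<ge> 0" and ex: "\<And>\<theta> i. \<theta> \<in> cbox 0 1 \<Longrightarrow> \<exists>c. P r M \<theta> i c"
    using uniform_axis_expansion[OF an compact_cbox, of 0 1, folded P_def] by blast
  define c where "c i \<theta> = (SOME c. P r M \<theta> i c)" for i \<theta>
  have Pc: "P r M \<theta> i (c i \<theta>)" if "\<theta> \<in> cbox 0 1" for \<theta> i
    unfolding c_def by (rule someI_ex[OF ex[OF that]])
  have c: "\<bar>c i \<theta> m\<bar> * r ^ m \<le> M" if "\<theta> \<in> cbox 0 1" for \<theta> i m
    using Pc[OF that] by (simp add: P_def)
  have c_sum: "((\<lambda>m. c i \<theta> m * t ^ m) has_sum f (\<theta> + axis i t)) UNIV" if "\<theta> \<in> cbox 0 1" "\<bar>t\<bar> \<le> r" for \<theta> i t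
    using Pc[OF that(1)] that(2) by (simp add: P_def)
  have c_cont: "continuous_on (cbox 0 1) (\<lambda>\<theta>. c i \<theta> m)" for i m
    by (rule continuous_axis_coeffs[OF fc r c c_sum])
  have "exp (pi * r * \<bar>of_int (k $ i)\<bar>) * norm (fcoeff ?f k) \<le> 2 * M" for k i
  proof -
    define F where "F = fcoeff ?f k"
    define y where "y = 2 * pi * of_int (k $ i)"
    define d where "d m = box_integral (\<lambda>\<theta>. of_real (c i \<theta> m) * mode (- k) \<theta>)" for m
    \<comment> \<open>Two expansions of the same function of \<open>t\<close>: \<open>d\<close> by termwise integration, \<open>b\<close> from the exponential series.\<close>
    define b where "b m = (\<i> * of_real y) ^ m / fact m * F" for m
    have d_bound: "norm (d m) * r ^ m \<le> M" for m
    proof -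
      have "norm (d m) \<le> M / r ^ m" unfolding d_def
        using c r M by (intro norm_box_integral_le continuous_intros c_cont)
          (auto simp: norm_mult field_simps)
      then show ?thesis using r by (simp add: field_simps)
    qed
    have d_sum: "(\<lambda>m. d m * of_real t ^ m) sums (cis (y * t) * F)" if t: "0 < t" "t < r" for t
    proof -
      have geo: "(\<lambda>m. M * (t / r) ^ m) summable_on UNIV"
        using M r t by (subst summable_on_UNIV_nonneg_real_iff)
          (auto intro!: summable_mult summable_geometric)
      have "((\<lambda>m. box_integral (\<lambda>\<theta>. of_real (c i \<theta> m * t ^ m) * mode (- k) \<theta>))
          has_sum box_integral (\<lambda>\<theta>. ?f (\<theta> + axis i t) * mode (- k) \<theta>)) UNIV"
      proof (rule integral_has_sum[OF _ geo])
        fix m and \<theta> :: "real ^ 'l" assume \<theta>: "\<theta> \<in> cbox 0 1"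
        have "\<bar>c i \<theta> m\<bar> * t ^ m = \<bar>c i \<theta> m\<bar> * r ^ m * (t / r) ^ m" using r by (simp add: power_divide)
        also have "\<dots> \<le> M * (t / r) ^ m" using t by (intro mult_right_mono c \<theta>) auto
        finally show "norm (of_real (c i \<theta> m * t ^ m) * mode (- k) \<theta>) \<le> M * (t / r) ^ m"
          using t by (simp add: norm_mult norm_power)
      next
        show "continuous_on (cbox 0 1) (\<lambda>\<theta>. of_real (c i \<theta> m * t ^ m) * mode (- k) \<theta>)" for m
          by (intro continuous_intros c_cont)
      next
        fix \<theta> :: "real ^ 'l" assume \<theta>: "\<theta> \<in> cbox 0 1"
        have "((\<lambda>m. c i \<theta> m * t ^ m) has_sum f (\<theta> + axis i t)) UNIV" using t by (intro c_sum \<theta>) auto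
        then show "((\<lambda>m. of_real (c i \<theta> m * t ^ m) * mode (- k) \<theta>) has_sum ?f (\<theta> + axis i t) * mode (- k) \<theta>) UNIV"
          by (intro has_sum_cmult_left has_sum_of_real)
      qed
      moreover have "box_integral (\<lambda>\<theta>. of_real (c i \<theta> m * t ^ m) * mode (- k) \<theta>) = d m * of_real t ^ m" for m
      proof -
        have "box_integral (\<lambda>\<theta>. of_real (c i \<theta> m * t ^ m) * mode (- k) \<theta>)
          = box_integral (\<lambda>\<theta>. (of_real (c i \<theta> m) * mode (- k) \<theta>) * of_real t ^ m)"
          by (simp add: mult_ac)
        then show ?thesis unfolding d_def by (simp only: integral_mult_left)
      qed
      moreover have "box_integral (\<lambda>\<theta>. ?f (\<theta> + axis i t) * mode (- k) \<theta>) = cis (y * t) * F"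
        using fcoeff_shift[OF cf pf, of "axis i t" k]
        by (simp add: fcoeff_def F_def mode_def inner_axis ivec_def y_def mult_ac)
      ultimately show ?thesis by (simp add: has_sum_imp_sums)
    qed
    have b_sum: "(\<lambda>m. b m * of_real t ^ m) sums (cis (y * t) * F)" for t
    proof -
      have "(\<lambda>m. (\<i> * of_real (y * t)) ^ m /\<^sub>R fact m * F) sums (exp (\<i> * of_real (y * t)) * F)"
        by (intro sums_mult2 exp_converges)
      then show ?thesis
        by (simp add: b_def cis_conv_exp power_mult_distrib scaleR_conv_of_real field_simps)
    qed
    obtain B where B: "\<And>m. norm (b m) * r ^ m \<le> B"
    proof -
      have "summable (\<lambda>m. b m * of_real r ^ m)" using b_sum sums_summable by blast
      then have "Bseq (\<lambda>m. b m * of_real r ^ m)" by (intro convergent_imp_Bseq) (auto dest: summable_LIMSEQ_zero simp: convergent_def)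
      then obtain B where "\<And>m. norm (b m * of_real r ^ m) \<le> B" unfolding Bseq_def by blast
      then show ?thesis using that[of B] r by (simp add: norm_mult norm_power)
    qed
    have "d m - b m = 0" for m
    proof (rule powser_zero_coeffs[OF r])
      show "norm (d j - b j) * r ^ j \<le> M + B" for j
      proof -
        have "norm (d j - b j) * r ^ j \<le> (norm (d j) + norm (b j)) * r ^ j"
          using r by (intro mult_right_mono norm_triangle_ineq4) auto
        then show ?thesis using d_bound[of j] B[of j] by (simp add: algebra_simps)
      qed
      show "(\<lambda>j. (d j - b j) * of_real t ^ j) sums 0" if "0 < t" "t < r" for t
        using sums_diff[OF d_sum[OF that] b_sum[of t]] by (simp add: algebra_simps)
    qed
    then have db: "d m = b m" for m by simp
    define z where "z = pi * r * \<bar>real_of_int (k $ i)\<bar>"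
    have "(\<lambda>m. z ^ m /\<^sub>R fact m * norm F) sums (exp z * norm F)"
      by (intro sums_mult2 exp_converges)
    moreover have "(\<lambda>m. M * (1/2) ^ m) sums (M * (1 / (1 - 1/2)))"
      by (intro sums_mult geometric_sums) auto
    moreover have "z ^ m /\<^sub>R fact m * norm F \<le> M * (1/2) ^ m" for m
    proof -
      have zy: "z = \<bar>y\<bar> * r * (1/2)" by (simp add: z_def y_def abs_mult)
      have "z ^ m /\<^sub>R fact m * norm F = norm (b m) * r ^ m * (1/2) ^ m"
        unfolding zy by (simp add: b_def norm_mult norm_divide norm_power power_mult_distrib field_simps)
      also have "\<dots> \<le> M * (1/2) ^ m" using d_bound[of m] by (intro mult_right_mono) (auto simp: db)
      finally show ?thesis .
    qed
    ultimately have "exp z * norm F \<le> M * (1 / (1 - 1/2))" by (rule sums_le[rotated])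
    then show ?thesis by (simp add: z_def F_def)
  qed
  moreover have "pi * r > 0" "2 * M \<ge> 0" using r M by auto
  ultimately show ?thesis by blast
qed

section \<open>Fourier series with exponentially decaying coefficients\<close>

text \<open>
  The product formula for the infinite sums holds even with the default value \<open>0\<close> of a sum that
  does not converge. Applied to the norms, a nonzero value of the product therefore forces
  convergence.
\<close>
lemma has_sum_prod_coordinates:
  fixes g :: "'l::finite \<Rightarrow> 'b \<Rightarrow> 'c::{banach, real_normed_field}"
  assumes g: "\<And>i. (\<lambda>b. norm (g i b)) summable_on UNIV"
  shows "((\<lambda>\<alpha>. \<Prod>i\<in>UNIV. g i (\<alpha> i)) has_sum (\<Prod>i\<in>UNIV. infsum (g i) UNIV)) UNIV"
proof -
  have PiE: "PiE (UNIV :: 'l set) (\<lambda>_. UNIV :: 'b set) = UNIV" by (auto simp: PiE_def)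
  have "(\<lambda>\<alpha>. \<Prod>i\<in>UNIV. norm (g i (\<alpha> i))) summable_on UNIV"
  proof (cases "\<exists>i. (\<Sum>\<^sub>\<infinity>b. norm (g i b)) = 0")
    case True
    then obtain i where i: "(\<Sum>\<^sub>\<infinity>b. norm (g i b)) = 0" by blast
    have "norm (g i b) = 0" for b
      by (rule nonneg_infsum_le_0D[where A = UNIV and f = "\<lambda>b. norm (g i b)"]) (use i g in auto)
    then have "(\<Prod>i\<in>UNIV. norm (g i (\<alpha> i))) = 0" for \<alpha>
      by (intro prod_zero) auto
    then show ?thesis by (simp only: summable_on_0_simp)
  next
    case False
    have "infsum (\<lambda>\<alpha>. \<Prod>i\<in>UNIV. norm (g i (\<alpha> i))) (PiE UNIV (\<lambda>_. UNIV)) = (\<Prod>i\<in>UNIV. \<Sum>\<^sub>\<infinity>b. norm (g i b))"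
      by (rule infsum_prod_PiE_abs) (use g in auto)
    also have "\<dots> \<noteq> 0" using False by simp
    finally show ?thesis unfolding PiE using infsum_not_exists by blast
  qed
  then have "(\<lambda>\<alpha>. norm (\<Prod>i\<in>UNIV. g i (\<alpha> i))) summable_on UNIV" by (simp add: prod_norm)
  then have "(\<lambda>\<alpha>. \<Prod>i\<in>UNIV. g i (\<alpha> i)) summable_on UNIV" by (rule abs_summable_summable)
  moreover have "infsum (\<lambda>\<alpha>. \<Prod>i\<in>UNIV. g i (\<alpha> i)) (PiE UNIV (\<lambda>_. UNIV)) = (\<Prod>i\<in>UNIV. infsum (g i) UNIV)"
    by (rule infsum_prod_PiE_abs) (use g in auto)
  ultimately show ?thesis unfolding PiE by (simp add: has_sum_iff)
qed

lemma has_sum_exp: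
  fixes x :: "'a::{real_normed_field, banach}"
  shows "((\<lambda>n. x ^ n / fact n) has_sum exp x) UNIV" "(\<lambda>n. norm (x ^ n / fact n)) summable_on UNIV"
proof -
  have 1: "summable (\<lambda>n. norm (x ^ n / fact n))"
    using summable_norm_exp[of x] by (simp add: scaleR_conv_of_real field_simps norm_divide)
  have 2: "(\<lambda>n. x ^ n / fact n) sums exp x"
    using exp_converges[of x] by (simp add: scaleR_conv_of_real field_simps)
  show "((\<lambda>n. x ^ n / fact n) has_sum exp x) UNIV" by (rule norm_summable_imp_has_sum[OF 1 2])
  show "(\<lambda>n. norm (x ^ n / fact n)) summable_on UNIV"
    using 1 by (subst summable_on_UNIV_nonneg_real_iff) auto
qed

lemma has_sum_prod_exp:
  fixes z :: "'l::finite \<Rightarrow> 'c::{real_normed_field, banach}"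
  shows "((\<lambda>\<alpha>. \<Prod>i\<in>UNIV. z i ^ \<alpha> i / fact (\<alpha> i)) has_sum exp (\<Sum>i\<in>UNIV. z i)) UNIV"
proof -
  have "infsum (\<lambda>n. x ^ n / fact n) UNIV = exp x" for x :: 'c
    using has_sum_exp(1)[of x] by (rule infsumI)
  then show ?thesis
    using has_sum_prod_coordinates[of "\<lambda>i n. z i ^ n / fact n", OF has_sum_exp(2)]
    by (simp only: exp_sum finite)
qed

text \<open>
  The $\ell^1$ norm makes exponential weights products over the coordinates, so that sums over the
  frequency lattice factorise.
\<close>
definition l1 :: "int ^ 'l::finite \<Rightarrow> real" where
  "l1 k = (\<Sum>i\<in>UNIV. \<bar>of_int (k $ i)\<bar>)"

lemma l1_nonneg: "l1 k \<ge> 0"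
  by (simp add: l1_def sum_nonneg)

lemma exp_weight_ge_1: "\<epsilon> > 0 \<Longrightarrow> 1 \<le> exp (\<epsilon> * l1 k)"
  using l1_nonneg[of k] by simp

text \<open>
  Expanding $e_k(x+h)$ in powers of \<open>h\<close> costs a factor $e^{2\pi s|k|_1}$ in the absolute sum over
  multi-indices on the cube of half-side \<open>s\<close>; the choice $2\pi s = \epsilon$ makes this the weight
  in the hypothesis.
\<close>
lemma fourier_series_real_analytic:
  fixes w :: "int ^ 'l::finite \<Rightarrow> complex"
  assumes \<epsilon>: "\<epsilon> > 0" and w: "(\<lambda>k. norm (w k) * exp (\<epsilon> * l1 k)) summable_on UNIV"
  shows "real_analytic (\<lambda>\<theta>. Re (\<Sum>\<^sub>\<infinity>k. w k * mode k \<theta>))"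
proof (rule expands_imp_real_analytic)
  fix x :: "real ^ 'l"
  define s where "s = \<epsilon> / (2 * pi)"
  have s: "s > 0" using \<epsilon> by (simp add: s_def)
  define e where "e k \<alpha> = (\<Prod>i\<in>UNIV. (\<i> * of_real (2 * pi * of_int (k $ i))) ^ \<alpha> i / fact (\<alpha> i))"
    for k :: "int ^ 'l" and \<alpha> :: "'l \<Rightarrow> nat"
  define c where "c p = w (fst p) * mode (fst p) x * e (fst p) (snd p)" for p
  have norm_e: "norm (e k \<alpha>) * s ^ mdeg \<alpha> = (\<Prod>i\<in>UNIV. (\<epsilon> * \<bar>of_int (k $ i)\<bar>) ^ \<alpha> i / fact (\<alpha> i))" for k \<alpha>
  proof -
    have "norm (e k \<alpha>) = (\<Prod>i\<in>UNIV. (2 * pi * \<bar>of_int (k $ i)\<bar>) ^ \<alpha> i / fact (\<alpha> i))"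
      by (simp add: e_def norm_divide norm_power norm_mult flip: prod_norm)
    then have "norm (e k \<alpha>) * s ^ mdeg \<alpha> = (\<Prod>i\<in>UNIV. (2 * pi * \<bar>of_int (k $ i)\<bar>) ^ \<alpha> i / fact (\<alpha> i) * s ^ \<alpha> i)"
      by (simp only: power_sum prod.distrib)
    also have "\<dots> = (\<Prod>i\<in>UNIV. (\<epsilon> * \<bar>of_int (k $ i)\<bar>) ^ \<alpha> i / fact (\<alpha> i))"
      by (intro prod.cong refl) (simp add: s_def power_divide power_mult_distrib)
    finally show ?thesis .
  qed
  let ?W = "\<lambda>p. norm (c p) * s ^ mdeg (snd p)"
  have W1: "((\<lambda>\<alpha>. ?W (k, \<alpha>)) has_sum norm (w k) * exp (\<epsilon> * l1 k)) UNIV" for k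
  proof -
    have "((\<lambda>\<alpha>. norm (w k) * (norm (e k \<alpha>) * s ^ mdeg \<alpha>)) has_sum norm (w k) * exp (\<Sum>i\<in>UNIV. \<epsilon> * \<bar>of_int (k $ i)\<bar>)) UNIV"
      unfolding norm_e by (intro has_sum_cmult_right has_sum_prod_exp)
    then show ?thesis by (simp add: c_def norm_mult l1_def sum_distrib_left mult.assoc)
  qed
  have W: "?W summable_on UNIV \<times> UNIV"
    by (rule summable_on_SigmaI[OF W1 w]) (use s in auto)
  have Re_W: "(\<lambda>p. \<bar>Re (c p)\<bar> * s ^ mdeg (snd p)) summable_on UNIV"
  proof (rule summable_on_comparison_test)
    show "?W summable_on UNIV" using W by simp
    show "\<bar>Re (c p)\<bar> * s ^ mdeg (snd p) \<le> ?W p" for p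
      using s abs_Re_le_cmod by (intro mult_right_mono) auto
  qed (use s in auto)
  have "expands (\<lambda>\<theta>. Re (\<Sum>\<^sub>\<infinity>k. w k * mode k \<theta>)) x s
      (\<lambda>\<alpha>. infsum (\<lambda>p. Re (c p)) {p. snd p = \<alpha>}) (\<Sum>\<^sub>\<infinity>p. \<bar>Re (c p)\<bar> * s ^ mdeg (snd p))"
  proof (rule expands_group[OF s has_sum_infsum[OF Re_W]])
    fix h :: "real ^ 'l" assume h: "\<And>i. \<bar>h $ i\<bar> \<le> s"
    let ?v = "\<lambda>p. c p * of_real (monomial h (snd p))"
    have v1: "((\<lambda>\<alpha>. ?v (k, \<alpha>)) has_sum w k * mode k (x + h)) UNIV" for k
    proof -
      let ?z = "\<lambda>i. \<i> * of_real (2 * pi * of_int (k $ i) * h $ i)"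
      have eh: "e k \<alpha> * of_real (monomial h \<alpha>) = (\<Prod>i\<in>UNIV. ?z i ^ \<alpha> i / fact (\<alpha> i))" for \<alpha>
        unfolding e_def monomial_def of_real_prod prod.distrib[symmetric]
        by (intro prod.cong refl) (simp add: power_mult_distrib)
      have mh: "exp (\<Sum>i\<in>UNIV. ?z i) = mode k h"
        by (simp add: mode_def cis_conv_exp ivec_def inner_vec_def sum_distrib_left mult_ac)
      have "((\<lambda>\<alpha>. w k * mode k x * (e k \<alpha> * of_real (monomial h \<alpha>))) has_sum w k * mode k x * mode k h) UNIV"
        unfolding eh mh[symmetric] by (intro has_sum_cmult_right has_sum_prod_exp)
      then show ?thesis by (simp add: c_def mode_shift mult.assoc)
    qed
    have "(\<lambda>k. norm (w k * mode k (x + h))) summable_on UNIV"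
      by (rule Infinite_Sum.abs_summable_on_comparison_test'[OF w])
        (use mult_left_mono[OF exp_weight_ge_1[OF \<epsilon>] norm_ge_zero] in \<open>simp add: norm_mult\<close>)
    then have v2: "((\<lambda>k. w k * mode k (x + h)) has_sum (\<Sum>\<^sub>\<infinity>k. w k * mode k (x + h))) UNIV"
      by (intro has_sum_infsum abs_summable_summable[where f = "\<lambda>k. w k * mode k (x + h)"])
    have "(\<lambda>p. norm (?v p)) summable_on UNIV \<times> UNIV"
      by (rule Infinite_Sum.abs_summable_on_comparison_test'[OF W])
        (use monomial_bound[OF h] in \<open>simp add: norm_mult mult_left_mono\<close>)
    then have "?v summable_on UNIV \<times> UNIV" by (rule abs_summable_summable)
    from has_sum_Re[OF has_sum_SigmaI[OF v1 v2 this]]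
    show "((\<lambda>p. Re (c p) * monomial h (snd p)) has_sum Re (\<Sum>\<^sub>\<infinity>k. w k * mode k (x + h))) UNIV"
      by simp
  qed
  then show "\<exists>s a K. expands (\<lambda>\<theta>. Re (\<Sum>\<^sub>\<infinity>k. w k * mode k \<theta>)) x s a K" by blast
qed

lemma fourier_series_has_sum:
  assumes "(\<lambda>k. norm (w k)) summable_on UNIV"
  shows "((\<lambda>k. w k * mode k \<theta>) has_sum (\<Sum>\<^sub>\<infinity>k. w k * mode k \<theta>)) UNIV"
proof -
  have "(\<lambda>k. norm (w k * mode k \<theta>)) summable_on UNIV" using assms by (simp add: norm_mult)
  then have "(\<lambda>k. w k * mode k \<theta>) summable_on UNIV" by (rule abs_summable_summable)
  then show ?thesis by (rule has_sum_infsum)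
qed

lemma fourier_series_continuous:
  assumes w: "(\<lambda>k. norm (w k)) summable_on UNIV"
  shows "continuous_on S (\<lambda>\<theta>. \<Sum>\<^sub>\<infinity>k. w k * mode k \<theta>)"
  by (rule continuous_on_has_sum[OF _ w _ fourier_series_has_sum[OF w]])
    (auto simp: norm_mult intro!: continuous_intros)

lemma fourier_series_periodic: "torus_periodic (\<lambda>\<theta>. \<Sum>\<^sub>\<infinity>k. w k * mode k \<theta>)"
  by (simp add: torus_periodic_def mode_shift mode_ivec)

lemma fcoeff_fourier_series:
  assumes w: "(\<lambda>k. norm (w k)) summable_on UNIV"
  shows "fcoeff (\<lambda>\<theta>. \<Sum>\<^sub>\<infinity>k. w k * mode k \<theta>) j = w j"
proof -
  have "((\<lambda>k. box_integral (\<lambda>\<theta>. w k * mode k \<theta> * mode (- j) \<theta>)) has_sum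
      box_integral (\<lambda>\<theta>. (\<Sum>\<^sub>\<infinity>k. w k * mode k \<theta>) * mode (- j) \<theta>)) UNIV"
    by (rule integral_has_sum[OF _ w])
      (auto simp: norm_mult intro!: continuous_intros has_sum_cmult_left fourier_series_has_sum[OF w])
  moreover have "box_integral (\<lambda>\<theta>. w k * mode k \<theta> * mode (- j) \<theta>) = (if k = j then w j else 0)" for k
    using fcoeff_mode[of k j] by (simp add: fcoeff_def mult.assoc)
  ultimately have "((\<lambda>k. if k = j then w j else 0) has_sum fcoeff (\<lambda>\<theta>. \<Sum>\<^sub>\<infinity>k. w k * mode k \<theta>) j) UNIV"
    by (simp add: fcoeff_def)
  moreover have "((\<lambda>k. if k = j then w j else 0) has_sum w j) UNIV"
    by (rule has_sum_finite_neutralI[where B = "{j}"]) auto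
  ultimately show ?thesis by (rule has_sum_unique)
qed

lemma fcoeff_inject:
  assumes "continuous_on UNIV f" "torus_periodic f" "continuous_on UNIV g" "torus_periodic g"
    and "\<And>k. fcoeff f k = fcoeff g k"
  shows "f x = g x"
proof -
  have "1 * f x - g x = 0"
  proof (rule fcoeff_zero_imp_zero[where f = "\<lambda>x. 1 * f x - g x"])
    show "fcoeff (\<lambda>x. 1 * f x - g x) k = 0" for k
      by (subst fcoeff_linear) (use assms in auto)
  qed (use assms in \<open>auto simp: torus_periodic_def intro!: continuous_intros\<close>)
  then show ?thesis by simp
qed

lemma summable_exp_l1:
  assumes \<delta>: "\<delta> > 0"
  shows "(\<lambda>k :: int ^ 'l::finite. exp (- \<delta> * l1 k)) summable_on UNIV"
proof -
  have nat: "(\<lambda>n. exp (- \<delta>) ^ n) summable_on (UNIV :: nat set)"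
    using \<delta> by (subst summable_on_UNIV_nonneg_real_iff) (auto intro!: summable_geometric)
  let ?g = "\<lambda>n :: int. exp (- \<delta> * \<bar>of_int n\<bar>)"
  have "?g summable_on range int"
    by (subst summable_on_reindex) (use nat in \<open>auto simp: o_def mult.commute simp flip: exp_of_nat_mult\<close>)
  moreover have "?g summable_on range (\<lambda>n. - int n)"
    by (subst summable_on_reindex) (use nat in \<open>auto simp: o_def inj_on_def mult.commute simp flip: exp_of_nat_mult\<close>)
  ultimately have "?g summable_on (range int \<union> range (\<lambda>n. - int n))" by (rule summable_on_union)
  also have "range int \<union> range (\<lambda>n. - int n) = UNIV"
    by (auto simp: image_iff) (metis int_cases2)
  finally have g: "?g summable_on UNIV" .
  have "(\<lambda>\<alpha> :: 'l \<Rightarrow> int. \<Prod>i\<in>UNIV. ?g (\<alpha> i)) summable_on UNIV"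
    by (rule has_sum_imp_summable[OF has_sum_prod_coordinates]) (use g in simp)
  moreover have "(\<Prod>i\<in>UNIV. ?g (\<alpha> i)) = exp (- \<delta> * l1 (\<chi> i. \<alpha> i))" for \<alpha> :: "'l \<Rightarrow> int"
    by (simp add: l1_def sum_distrib_left exp_sum flip: sum_negf)
  ultimately have "(\<lambda>\<alpha> :: 'l \<Rightarrow> int. exp (- \<delta> * l1 (\<chi> i. \<alpha> i))) summable_on UNIV" by simp
  moreover have "bij_betw (\<lambda>\<alpha> :: 'l \<Rightarrow> int. \<chi> i. \<alpha> i) UNIV UNIV"
    by (rule bij_betwI[where g = vec_nth]) auto
  ultimately show ?thesis
    using summable_on_reindex_bij_betw[of "\<lambda>\<alpha> :: 'l \<Rightarrow> int. \<chi> i. \<alpha> i" UNIV UNIV "\<lambda>k. exp (- \<delta> * l1 k)"] by blast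
qed

text \<open>
  The decay in the coordinate of largest modulus controls the decay in $|k|_1$, at the price of
  dividing the rate by the dimension.
\<close>
lemma fcoeff_decay:
  fixes f :: "real ^ 'l::finite \<Rightarrow> real"
  assumes "torus_analytic f"
  shows "\<exists>\<delta>>0. \<exists>M. \<forall>k. norm (fcoeff (\<lambda>\<theta>. of_real (f \<theta>)) k) \<le> M * exp (- \<delta> * l1 k)"
proof -
  obtain \<delta> M where \<delta>: "\<delta> > 0" and M: "M \<ge> 0"
    and le: "\<And>k i. exp (\<delta> * \<bar>of_int (k $ i)\<bar>) * norm (fcoeff (\<lambda>\<theta>. of_real (f \<theta>)) k) \<le> M"
    using fcoeff_axis_decay[OF assms] by blast
  define N where "N = real CARD('l)"
  have N: "N > 0" by (simp add: N_def)
  have "norm (fcoeff (\<lambda>\<theta>. of_real (f \<theta>)) k) \<le> M * exp (- (\<delta> / N) * l1 k)" for k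
  proof -
    let ?F = "norm (fcoeff (\<lambda>\<theta>. of_real (f \<theta>)) k)"
    obtain i where i: "\<And>j. \<bar>k $ j\<bar> \<le> \<bar>k $ i\<bar>"
    proof -
      have "Max (range (\<lambda>j. \<bar>k $ j\<bar>)) \<in> range (\<lambda>j. \<bar>k $ j\<bar>)" by (intro Max_in) auto
      then obtain i where "Max (range (\<lambda>j. \<bar>k $ j\<bar>)) = \<bar>k $ i\<bar>" unfolding image_iff by blast
      moreover have "\<bar>k $ j\<bar> \<le> Max (range (\<lambda>j. \<bar>k $ j\<bar>))" for j by (intro Max_ge) auto
      ultimately have "\<bar>k $ j\<bar> \<le> \<bar>k $ i\<bar>" for j by simp
      then show ?thesis by (rule that)
    qed
    have "l1 k \<le> (\<Sum>j\<in>(UNIV :: 'l set). \<bar>of_int (k $ i)\<bar>)"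
      unfolding l1_def using i by (intro sum_mono) (simp flip: of_int_abs)
    then have "\<delta> / N * l1 k \<le> \<delta> / N * (N * \<bar>of_int (k $ i)\<bar>)"
      using \<delta> N by (intro mult_left_mono) (auto simp: N_def)
    then have "exp (\<delta> / N * l1 k) \<le> exp (\<delta> * \<bar>of_int (k $ i)\<bar>)" using N by simp
    then have "exp (\<delta> / N * l1 k) * ?F \<le> exp (\<delta> * \<bar>of_int (k $ i)\<bar>) * ?F" by (rule mult_right_mono) simp
    also have "\<dots> \<le> M" by (rule le)
    finally have "exp (\<delta> / N * l1 k) * ?F * exp (- (\<delta> / N) * l1 k) \<le> M * exp (- (\<delta> / N) * l1 k)"
      by (rule mult_right_mono) simp
    then show ?thesis by (simp add: mult.commute[of _ ?F] mult.assoc flip: exp_add)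
  qed
  then show ?thesis using \<delta> N by (meson divide_pos_pos)
qed

section \<open>Fourier inversion and Fourier multipliers\<close>

lemma multiplied_coeffs_summable:
  fixes f :: "real ^ 'l::finite \<Rightarrow> real"
  assumes f: "torus_analytic f"
    and d: "\<And>\<epsilon>. \<epsilon> > 0 \<Longrightarrow> \<exists>C. \<forall>k. norm (d k) \<le> C * exp (\<epsilon> * l1 k)"
  shows "\<exists>\<epsilon>>0. (\<lambda>k. norm (d k * fcoeff (\<lambda>\<theta>. of_real (f \<theta>)) k) * exp (\<epsilon> * l1 k)) summable_on UNIV"
proof -
  obtain \<delta> M where \<delta>: "\<delta> > 0" and M: "\<And>k. norm (fcoeff (\<lambda>\<theta>. of_real (f \<theta>)) k) \<le> M * exp (- \<delta> * l1 k)"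
    using fcoeff_decay[OF f] by blast
  \<comment> \<open>One third of the rate is lost to the multiplier, one third to the weight; the last one gives convergence.\<close>
  define \<epsilon> where "\<epsilon> = \<delta> / 3"
  have \<epsilon>: "\<epsilon> > 0" using \<delta> by (simp add: \<epsilon>_def)
  obtain C where C: "\<And>k. norm (d k) \<le> C * exp (\<epsilon> * l1 k)" using d[OF \<epsilon>] by blast
  have "(\<lambda>k. norm (d k * fcoeff (\<lambda>\<theta>. of_real (f \<theta>)) k) * exp (\<epsilon> * l1 k)) summable_on UNIV"
  proof (rule summable_on_comparison_test)
    show "(\<lambda>k :: int ^ 'l. C * M * exp (- \<epsilon> * l1 k)) summable_on UNIV"
      by (intro summable_on_cmult_right summable_exp_l1 \<epsilon>)
    fix k :: "int ^ 'l"
    have "norm (d k * fcoeff (\<lambda>\<theta>. of_real (f \<theta>)) k) * exp (\<epsilon> * l1 k)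
        \<le> (C * exp (\<epsilon> * l1 k)) * (M * exp (- \<delta> * l1 k)) * exp (\<epsilon> * l1 k)"
      unfolding norm_mult using order_trans[OF norm_ge_zero C[of k]]
      by (intro mult_right_mono mult_mono C M) auto
    also have "\<dots> = C * M * (exp (\<epsilon> * l1 k) * exp (- \<delta> * l1 k) * exp (\<epsilon> * l1 k))" by (simp only: mult_ac)
    also have "exp (\<epsilon> * l1 k) * exp (- \<delta> * l1 k) * exp (\<epsilon> * l1 k) = exp (- \<epsilon> * l1 k)"
      by (simp add: \<epsilon>_def field_simps flip: exp_add)
    finally show "norm (d k * fcoeff (\<lambda>\<theta>. of_real (f \<theta>)) k) * exp (\<epsilon> * l1 k) \<le> C * M * exp (- \<epsilon> * l1 k)" .
  qed auto
  then show ?thesis using \<epsilon> by blast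
qed

lemma summable_drop_weight:
  assumes "\<epsilon> > 0" "(\<lambda>k. norm (w k) * exp (\<epsilon> * l1 k)) summable_on UNIV"
  shows "(\<lambda>k. norm (w k)) summable_on UNIV"
  by (rule summable_on_comparison_test[OF assms(2)])
    (use mult_left_mono[OF exp_weight_ge_1[OF assms(1)] norm_ge_zero] in simp_all)

lemma torus_analytic_continuous:
  "torus_analytic f \<Longrightarrow> continuous_on S (\<lambda>\<theta>. complex_of_real (f \<theta>))"
  by (intro continuous_intros real_analytic_continuous) (simp add: torus_analytic_def)

lemma torus_analytic_periodic:
  "torus_analytic f \<Longrightarrow> torus_periodic (\<lambda>\<theta>. complex_of_real (f \<theta>))"
  by (simp add: torus_analytic_def torus_periodic_def)

text \<open>
  The series converges to a continuous function with the same coefficients as \<open>f\<close>.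
\<close>
lemma fourier_inversion:
  assumes f: "torus_analytic f"
  shows "((\<lambda>k. fcoeff (\<lambda>\<theta>. of_real (f \<theta>)) k * mode k \<theta>) has_sum of_real (f \<theta>)) UNIV"
proof -
  let ?F = "\<lambda>\<theta>. complex_of_real (f \<theta>)"
  have "\<exists>C. \<forall>k. norm ((\<lambda>_. 1 :: complex) k) \<le> C * exp (\<epsilon> * l1 k)" if "\<epsilon> > 0" for \<epsilon>
    using exp_weight_ge_1[OF that] by (intro exI[of _ 1] allI) simp
  from multiplied_coeffs_summable[OF f this] obtain \<epsilon> where
    "\<epsilon> > 0" "(\<lambda>k. norm (fcoeff ?F k) * exp (\<epsilon> * l1 k)) summable_on UNIV" by auto
  then have w: "(\<lambda>k. norm (fcoeff ?F k)) summable_on UNIV" by (rule summable_drop_weight)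
  have "(\<Sum>\<^sub>\<infinity>k. fcoeff ?F k * mode k \<theta>) = ?F \<theta>"
    by (rule fcoeff_inject[OF fourier_series_continuous[OF w] fourier_series_periodic
          torus_analytic_continuous[OF f] torus_analytic_periodic[OF f] fcoeff_fourier_series[OF w]])
  then show ?thesis using fourier_series_has_sum[OF w, of \<theta>] by simp
qed

lemma fcoeff_inject_real:
  assumes "torus_analytic f" "torus_analytic g"
    and "\<And>k. fcoeff (\<lambda>\<theta>. of_real (f \<theta>)) k = fcoeff (\<lambda>\<theta>. of_real (g \<theta>)) k"
  shows "f = g"
proof
  fix \<theta>
  have "complex_of_real (f \<theta>) = of_real (g \<theta>)"
    by (rule fcoeff_inject[where f = "\<lambda>\<theta>. complex_of_real (f \<theta>)" and g = "\<lambda>\<theta>. complex_of_real (g \<theta>)"])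
      (intro torus_analytic_continuous torus_analytic_periodic assms)+
  then show "f \<theta> = g \<theta>" by simp
qed

lemma torus_integral_Re:
  assumes "continuous_on UNIV G"
  shows "torus_integral (\<lambda>\<theta>. Re (G \<theta>)) = Re (fcoeff G 0)"
proof -
  have "G integrable_on cbox 0 1"
    by (intro integrable_continuous continuous_on_subset[OF assms]) auto
  from integral_linear[OF this bounded_linear_Re]
  have "integral (cbox 0 1) (\<lambda>\<theta>. Re (G \<theta>)) = Re (box_integral G)" by (simp add: o_def)
  moreover have "torus_integral (\<lambda>\<theta>. Re (G \<theta>)) = integral (cbox 0 1) (\<lambda>\<theta>. Re (G \<theta>))"
    by (intro torus_integral_eq continuous_intros assms)
  ultimately show ?thesis by (simp add: fcoeff_def)
qed

lemma fcoeff_0: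
  assumes f: "torus_analytic f"
  shows "fcoeff (\<lambda>\<theta>. of_real (f \<theta>)) 0 = of_real (torus_integral f)"
proof -
  have c: "continuous_on S f" for S using f by (simp add: torus_analytic_def real_analytic_continuous)
  have "f integrable_on cbox 0 1" by (intro integrable_continuous c)
  from integral_linear[OF this bounded_linear_of_real[where 'a = complex]]
  have "box_integral (\<lambda>\<theta>. of_real (f \<theta>)) = of_real (integral (cbox 0 1) f)" by (simp add: o_def)
  then show ?thesis using torus_integral_eq[OF c] by (simp add: fcoeff_def)
qed

text \<open>
  The common source of the solutions of both equations. The multiplier \<open>d\<close> stands for the inverse
  divisors; the divisors reappear as a factor, so that the caller can cancel them even when some
  of them vanish.
\<close>
lemma multiplier_solution:
  fixes f :: "real ^ 'l::finite \<Rightarrow> real"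
  assumes f: "torus_analytic f"
    and d: "\<And>\<epsilon>. \<epsilon> > 0 \<Longrightarrow> \<exists>C. \<forall>k. norm (d k) \<le> C * exp (\<epsilon> * l1 k)"
  shows "\<exists>W. torus_analytic W \<and>
     torus_integral W = Re (d 0 * fcoeff (\<lambda>\<theta>. of_real (f \<theta>)) 0) \<and>
     (\<forall>\<theta>. ((\<lambda>k. Re (d k * (of_real \<mu> - mode k \<omega>) * fcoeff (\<lambda>\<theta>. of_real (f \<theta>)) k * mode k \<theta>))
        has_sum \<mu> * W \<theta> - W (\<theta> + \<omega>)) UNIV)"
proof -
  let ?F = "fcoeff (\<lambda>\<theta>. complex_of_real (f \<theta>))"
  define w where "w k = d k * ?F k" for k
  define G where "G \<theta> = (\<Sum>\<^sub>\<infinity>k. w k * mode k \<theta>)" for \<theta>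
  obtain \<epsilon> where \<epsilon>: "\<epsilon> > 0" and we: "(\<lambda>k. norm (w k) * exp (\<epsilon> * l1 k)) summable_on UNIV"
    using multiplied_coeffs_summable[OF f d] unfolding w_def by blast
  have w: "(\<lambda>k. norm (w k)) summable_on UNIV" by (rule summable_drop_weight[OF \<epsilon> we])
  have "torus_analytic (\<lambda>\<theta>. Re (G \<theta>))"
    using fourier_series_real_analytic[OF \<epsilon> we] fourier_series_periodic[of w]
    by (simp add: torus_analytic_def torus_periodic_def G_def)
  moreover have "torus_integral (\<lambda>\<theta>. Re (G \<theta>)) = Re (d 0 * ?F 0)"
  proof -
    have "continuous_on UNIV G" unfolding G_def by (rule fourier_series_continuous[OF w])
    moreover have "fcoeff G 0 = w 0"
      using fcoeff_fourier_series[OF w] by (simp add: G_def[abs_def])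
    ultimately show ?thesis by (simp add: torus_integral_Re w_def)
  qed
  moreover have "((\<lambda>k. Re (d k * (of_real \<mu> - mode k \<omega>) * ?F k * mode k \<theta>))
        has_sum \<mu> * Re (G \<theta>) - Re (G (\<theta> + \<omega>))) UNIV" for \<theta>
  proof -
    note G = fourier_series_has_sum[OF w, folded G_def]
    have "((\<lambda>k. of_real \<mu> * (w k * mode k \<theta>) + - (w k * mode k (\<theta> + \<omega>))) has_sum
       of_real \<mu> * G \<theta> + - G (\<theta> + \<omega>)) UNIV"
      by (intro has_sum_add has_sum_cmult_right has_sum_uminusI G)
    from has_sum_Re[OF this] show ?thesis
      by (simp add: w_def mode_shift algebra_simps)
  qed
  ultimately show ?thesis by blast
qed

lemma fcoeff_of_equation:
  assumes W: "torus_analytic W" and eq: "\<And>\<theta>. \<mu> * W \<theta> - W (\<theta> + \<omega>) = g \<theta>"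
  shows "(of_real \<mu> - mode k \<omega>) * fcoeff (\<lambda>\<theta>. of_real (W \<theta>)) k = fcoeff (\<lambda>\<theta>. of_real (g \<theta>)) k"
proof -
  let ?W = "\<lambda>\<theta>. complex_of_real (W \<theta>)"
  note c = torus_analytic_continuous[OF W] and p = torus_analytic_periodic[OF W]
  have "complex_of_real (g \<theta>) = of_real \<mu> * ?W \<theta> - ?W (\<theta> + \<omega>)" for \<theta>
    by (simp flip: eq)
  then have "fcoeff (\<lambda>\<theta>. of_real (g \<theta>)) k = fcoeff (\<lambda>\<theta>. of_real \<mu> * ?W \<theta> - ?W (\<theta> + \<omega>)) k" by simp
  also have "\<dots> = of_real \<mu> * fcoeff ?W k - fcoeff (\<lambda>\<theta>. ?W (\<theta> + \<omega>)) k"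
    by (intro fcoeff_linear c continuous_on_shift[OF c])
  also have "fcoeff (\<lambda>\<theta>. ?W (\<theta> + \<omega>)) k = mode k \<omega> * fcoeff ?W k"
    by (rule fcoeff_shift[OF c p])
  finally show ?thesis by (simp add: algebra_simps)
qed

section \<open>Small divisors\<close>

text \<open>
  A weakened form of Jordan's inequality, from which $|1 - e^{2\pi i x}|$ is at least twice the distance
  of $x$ to the integers.
\<close>
lemma sin_ge_linear:
  assumes "0 \<le> y" "y \<le> pi / 2"
  shows "y / pi \<le> sin y"
proof (cases "y \<le> pi / 3")
  case True
  have "y / 2 \<le> sin y"
  proof (cases "y = 0")
    case False
    then have "0 < y" using assms by simp
    from MVT2[OF this, of sin cos] obtain z where z: "0 < z" "z < y" "sin y - sin 0 = (y - 0) * cos z" by auto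
    have "cos (pi / 3) \<le> cos z" using z True pi_gt3 by (intro cos_monotone_0_pi_le) auto
    then have "y * (1 / 2) \<le> y * cos z" using assms by (intro mult_left_mono) (auto simp: cos_60)
    then show ?thesis using z(3) by simp
  qed simp
  moreover have "y / pi \<le> y / 2" using assms pi_gt3 by (intro divide_left_mono) auto
  ultimately show ?thesis by linarith
next
  case False
  have "sin (pi / 6) \<le> sin y" using False assms pi_gt_zero by (intro sin_monotone_2pi_le) auto
  moreover have "y / pi \<le> 1 / 2" using assms pi_gt_zero by (simp add: field_simps)
  ultimately show ?thesis unfolding sin_30 by linarith
qed

lemma norm_cis_minus_one_ge:
  fixes x :: real
  shows "\<exists>n::int. 2 * \<bar>x - of_int n\<bar> \<le> norm (1 - cis (2 * pi * x))"
proof -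
  define n where "n = round x"
  define y where "y = x - of_int n"
  have y: "\<bar>y\<bar> \<le> 1 / 2" using of_int_round_abs_le[of x] by (simp add: y_def n_def abs_minus_commute)
  have "cis (2 * pi * x) = cis (2 * pi * y) * cis (2 * pi * of_int n)"
    by (simp add: cis_mult y_def algebra_simps)
  also have "cis (2 * pi * of_int n) = 1" by (rule cis_multiple_2pi) (rule Ints_of_int)
  finally have e: "cis (2 * pi * x) = cis (2 * pi * y)" by simp
  have "norm (1 - cis (2 * pi * y)) = 2 * \<bar>sin (pi * y)\<bar>"
    using dist_exp_i_1[of "2 * pi * y"] by (simp add: cis_conv_exp norm_minus_commute)
  moreover have "\<bar>y\<bar> \<le> \<bar>sin (pi * y)\<bar>"
  proof -
    have "pi * \<bar>y\<bar> / pi \<le> sin (pi * \<bar>y\<bar>)"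
      using y by (intro sin_ge_linear) (auto simp: mult_left_mono)
    moreover have "sin (pi * \<bar>y\<bar>) \<le> \<bar>sin (pi * y)\<bar>" by (cases "y \<ge> 0") auto
    ultimately show ?thesis by simp
  qed
  ultimately show ?thesis unfolding e by (intro exI[of _ n]) (simp add: y_def)
qed

lemma small_divisor_bound:
  assumes "diophantine \<omega>"
  shows "\<exists>c>0. \<exists>\<tau>>0. \<forall>k. k \<noteq> 0 \<longrightarrow>
     1 - mode k \<omega> \<noteq> 0 \<and> norm (inverse (1 - mode k \<omega>)) \<le> c * norm (ivec k) powr \<tau>"
proof -
  obtain c \<tau> where c: "c > 0" and \<tau>: "\<tau> > 0" and D: "\<forall>k. k \<noteq> 0 \<longrightarrow> (\<forall>n::int.
        \<omega> \<bullet> ivec k - of_int n \<noteq> 0 \<and>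
        inverse \<bar>\<omega> \<bullet> ivec k - of_int n\<bar> \<le> c * norm (ivec k) powr \<tau>)"
    using assms unfolding diophantine_def by (elim exE conjE) (rule that)
  have "1 - mode k \<omega> \<noteq> 0 \<and> norm (inverse (1 - mode k \<omega>)) \<le> c * norm (ivec k) powr \<tau>" if k: "k \<noteq> 0" for k
  proof -
    obtain n :: int where n: "2 * \<bar>ivec k \<bullet> \<omega> - of_int n\<bar> \<le> norm (1 - mode k \<omega>)"
      using norm_cis_minus_one_ge[of "ivec k \<bullet> \<omega>"] unfolding mode_def by blast
    define u where "u = \<bar>ivec k \<bullet> \<omega> - of_int n\<bar>"
    have u: "u > 0" "inverse u \<le> c * norm (ivec k) powr \<tau>"
      using D[rule_format, OF k, of n] by (auto simp: u_def inner_commute)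
    have "2 * u \<le> norm (1 - mode k \<omega>)" using n by (simp add: u_def)
    then have le: "u \<le> norm (1 - mode k \<omega>)" using u(1) by linarith
    then have "norm (inverse (1 - mode k \<omega>)) \<le> inverse u"
      using u(1) unfolding norm_inverse by (intro le_imp_inverse_le) auto
    then show ?thesis using u le by auto
  qed
  then show ?thesis using c \<tau> by (intro exI[of _ c] exI[of _ \<tau>]) auto
qed

lemma powr_le_exp:
  fixes \<tau> \<epsilon> :: real
  assumes "\<tau> > 0" "\<epsilon> > 0"
  shows "\<exists>C\<ge>0. \<forall>x>0. x powr \<tau> \<le> C * exp (\<epsilon> * x)"
proof -
  \<comment> \<open>Chosen so that the bound \<open>ln (a * x) \<le> a * x\<close>, multiplied by \<open>\<tau>\<close>, has slope \<open>\<epsilon>\<close>.\<close>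
  define a where "a = \<epsilon> / \<tau>"
  have a: "a > 0" using assms by (simp add: a_def)
  have "x powr \<tau> \<le> exp (- \<tau> * ln a) * exp (\<epsilon> * x)" if x: "x > 0" for x
  proof -
    have "ln (a * x) \<le> a * x" using ln_le_minus_one[of "a * x"] a x by simp
    then have "ln x \<le> a * x - ln a" using a x by (simp add: ln_mult)
    then have "\<tau> * ln x \<le> \<tau> * (a * x - ln a)" using assms by (intro mult_left_mono) auto
    also have "\<dots> = - \<tau> * ln a + \<epsilon> * x" using assms by (simp add: a_def algebra_simps)
    finally show ?thesis using x by (simp add: powr_def mult.commute flip: exp_add)
  qed
  then show ?thesis by (intro exI[of _ "exp (- \<tau> * ln a)"]) auto
qed

text \<open>
  The value \<open>0\<close> at \<open>k = 0\<close> encodes that the average of the solution is normalised to zero.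
\<close>
lemma small_divisors_subexponential:
  fixes \<omega> :: "real ^ 'l::finite"
  assumes "diophantine \<omega>" and \<epsilon>: "\<epsilon> > 0"
  shows "\<exists>C. \<forall>k. norm (if k = 0 then 0 else inverse (1 - mode k \<omega>)) \<le> C * exp (\<epsilon> * l1 k)"
proof -
  obtain c \<tau> where c: "c > 0" and \<tau>: "\<tau> > 0" and
    D: "\<And>k. k \<noteq> 0 \<Longrightarrow> norm (inverse (1 - mode k \<omega>)) \<le> c * norm (ivec k) powr \<tau>"
    using small_divisor_bound[OF assms(1)] by blast
  obtain C where C: "C \<ge> 0" "\<And>x. x > 0 \<Longrightarrow> x powr \<tau> \<le> C * exp (\<epsilon> * x)"
    using powr_le_exp[OF \<tau> \<epsilon>] by blast
  have "norm (if k = 0 then 0 else inverse (1 - mode k \<omega>)) \<le> c * C * exp (\<epsilon> * l1 k)" for k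
  proof (cases "k = 0")
    case True then show ?thesis using c C(1) by simp
  next
    case False
    have le: "norm (ivec k) \<le> l1 k"
      using norm_le_l1_cart[of "ivec k"] by (simp add: l1_def ivec_def)
    have "0 < norm (ivec k)" using False by (simp add: ivec_def vec_eq_iff)
    then have pos: "l1 k > 0" using le by linarith
    have "norm (ivec k) powr \<tau> \<le> l1 k powr \<tau>" using \<tau> le by (intro powr_mono2) auto
    also have "\<dots> \<le> C * exp (\<epsilon> * l1 k)" by (rule C(2)[OF pos])
    finally have "c * norm (ivec k) powr \<tau> \<le> c * (C * exp (\<epsilon> * l1 k))"
      using c by (intro mult_left_mono) auto
    then show ?thesis using D[OF False] False by simp
  qed
  then show ?thesis by blast
qed

section \<open>Closure properties of analytic functions on the torus\<close>

lemma torus_analytic_mult: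
  "torus_analytic f \<Longrightarrow> torus_analytic g \<Longrightarrow> torus_analytic (\<lambda>\<theta>. f \<theta> * g \<theta>)"
  by (simp add: torus_analytic_def torus_periodic_def real_analytic_mult)

lemma torus_analytic_inverse:
  "torus_analytic f \<Longrightarrow> (\<And>\<theta>. f \<theta> \<noteq> 0) \<Longrightarrow> torus_analytic (\<lambda>\<theta>. inverse (f \<theta>))"
  by (simp add: torus_analytic_def torus_periodic_def real_analytic_inverse)

lemma torus_analytic_ln:
  "torus_analytic f \<Longrightarrow> (\<And>\<theta>. f \<theta> > 0) \<Longrightarrow> torus_analytic (\<lambda>\<theta>. ln (f \<theta>))"
  by (simp add: torus_analytic_def torus_periodic_def real_analytic_ln)

lemma torus_analytic_exp:
  "torus_analytic f \<Longrightarrow> torus_analytic (\<lambda>\<theta>. exp (f \<theta>))"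
  by (simp add: torus_analytic_def torus_periodic_def real_analytic_exp)

lemma torus_analytic_shift:
  "torus_analytic f \<Longrightarrow> torus_analytic (\<lambda>\<theta>. f (\<theta> + v))"
  by (simp add: torus_analytic_def torus_periodic_shift real_analytic_shift)

section \<open>The two linear equations over the rotation\<close>

lemma zero_average_solution_exists:
  fixes L :: "real ^ 'l::finite \<Rightarrow> real"
  assumes \<omega>: "diophantine \<omega>" and L: "torus_analytic L"
  shows "\<exists>W. torus_analytic W \<and> torus_integral W = 0 \<and>
     (\<forall>\<theta>. W \<theta> - W (\<theta> + \<omega>) = L \<theta> - torus_integral L)"
proof -
  let ?F = "fcoeff (\<lambda>\<theta>. complex_of_real (L \<theta>))"
  let ?d = "\<lambda>k. if k = 0 then 0 else inverse (1 - mode k \<omega>)"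
  obtain W where W: "torus_analytic W" "torus_integral W = Re (?d 0 * ?F 0)" and
    s: "\<And>\<theta>. ((\<lambda>k. Re (?d k * (of_real 1 - mode k \<omega>) * ?F k * mode k \<theta>)) has_sum 1 * W \<theta> - W (\<theta> + \<omega>)) UNIV"
    using multiplier_solution[OF L small_divisors_subexponential[OF \<omega>], of 1 \<omega>] by blast
  have nz: "1 - mode k \<omega> \<noteq> 0" if "k \<noteq> 0" for k using small_divisor_bound[OF \<omega>] that by blast
  then have cancel: "?d k * (of_real 1 - mode k \<omega>) = (if k = 0 then 0 else 1)" for k by simp
  have "W \<theta> - W (\<theta> + \<omega>) = L \<theta> - torus_integral L" for \<theta>
  proof -
    have "((\<lambda>k. if k = 0 then - ?F 0 else 0) has_sum - ?F 0) UNIV"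
      by (rule has_sum_finite_neutralI[where B = "{0}"]) auto
    from has_sum_Re[OF has_sum_add[OF fourier_inversion[OF L, of \<theta>] this]]
    have "((\<lambda>k. Re (?F k * mode k \<theta> + (if k = 0 then - ?F 0 else 0))) has_sum L \<theta> - torus_integral L) UNIV"
      by (simp add: fcoeff_0[OF L])
    also have "(\<lambda>k. Re (?F k * mode k \<theta> + (if k = 0 then - ?F 0 else 0)))
        = (\<lambda>k. Re ((if k = 0 then 0 else 1) * ?F k * mode k \<theta>))"
      by (intro ext) simp
    finally show ?thesis using has_sum_unique[OF s[of \<theta>, unfolded cancel]] by simp
  qed
  with W show ?thesis by auto
qed

lemma zero_average_solution_unique:
  assumes \<omega>: "diophantine \<omega>" and V: "torus_analytic V" "torus_integral V = 0" "\<And>\<theta>. V \<theta> - V (\<theta> + \<omega>) = g \<theta>"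
    and W: "torus_analytic W" "torus_integral W = 0" "\<And>\<theta>. W \<theta> - W (\<theta> + \<omega>) = g \<theta>"
  shows "V = W"
proof (rule fcoeff_inject_real[OF V(1) W(1)])
  fix k
  show "fcoeff (\<lambda>\<theta>. of_real (V \<theta>)) k = fcoeff (\<lambda>\<theta>. of_real (W \<theta>)) k"
  proof (cases "k = 0")
    case True then show ?thesis using fcoeff_0[OF V(1)] fcoeff_0[OF W(1)] V(2) W(2) by simp
  next
    case False
    then have "1 - mode k \<omega> \<noteq> 0" using small_divisor_bound[OF \<omega>] by blast
    moreover have "(1 - mode k \<omega>) * fcoeff (\<lambda>\<theta>. of_real (V \<theta>)) k = (1 - mode k \<omega>) * fcoeff (\<lambda>\<theta>. of_real (W \<theta>)) k"
      using fcoeff_of_equation[OF V(1), of 1 \<omega> g k] fcoeff_of_equation[OF W(1), of 1 \<omega> g k] V(3) W(3) by simp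
    ultimately show ?thesis by simp
  qed
qed

text \<open>
  The values of a character have modulus \<open>1\<close>, whereas a positive \<open>\<nu>\<close> has modulus \<open>\<nu>\<close>.
\<close>
lemma twisted_divisor_nonzero:
  assumes "\<nu> \<noteq> 1" "\<nu> > 0"
  shows "of_real \<nu> - mode k \<omega> \<noteq> 0"
proof
  assume "of_real \<nu> - mode k \<omega> = 0"
  then have "norm (complex_of_real \<nu>) = norm (mode k \<omega>)" by simp
  with assms show False by simp
qed

lemma twisted_solution_exists:
  fixes g :: "real ^ 'l::finite \<Rightarrow> real"
  assumes \<nu>: "\<nu> \<noteq> 1" "\<nu> > 0" and g: "torus_analytic g"
  shows "\<exists>W. torus_analytic W \<and> (\<forall>\<theta>. \<nu> * W \<theta> - W (\<theta> + \<omega>) = g \<theta>)"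
proof -
  let ?F = "fcoeff (\<lambda>\<theta>. complex_of_real (g \<theta>))"
  let ?d = "\<lambda>k. inverse (of_real \<nu> - mode k \<omega>)"
  have gap: "\<bar>\<nu> - 1\<bar> \<le> norm (of_real \<nu> - mode k \<omega>)" for k
    using norm_triangle_ineq3[of "of_real \<nu>" "mode k \<omega>"] \<nu> by simp
  have cancel: "?d k * (of_real \<nu> - mode k \<omega>) = 1" for k
    using twisted_divisor_nonzero[OF \<nu>, of k \<omega>] by simp
  have "\<exists>C. \<forall>k. norm (?d k) \<le> C * exp (\<epsilon> * l1 k)" if \<epsilon>: "\<epsilon> > 0" for \<epsilon>
  proof (intro exI allI)
    fix k :: "int ^ 'l"
    have "norm (?d k) \<le> inverse \<bar>\<nu> - 1\<bar>"
      unfolding norm_inverse using gap[of k] \<nu>(1) by (intro le_imp_inverse_le) auto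
    also have "\<dots> \<le> inverse \<bar>\<nu> - 1\<bar> * exp (\<epsilon> * l1 k)"
      using mult_left_mono[OF exp_weight_ge_1[OF \<epsilon>, of k], of "inverse \<bar>\<nu> - 1\<bar>"] by simp
    finally show "norm (?d k) \<le> inverse \<bar>\<nu> - 1\<bar> * exp (\<epsilon> * l1 k)" .
  qed
  from multiplier_solution[OF g this, of \<nu> \<omega>] obtain W where W: "torus_analytic W" and
    s: "\<And>\<theta>. ((\<lambda>k. Re (?d k * (of_real \<nu> - mode k \<omega>) * ?F k * mode k \<theta>)) has_sum \<nu> * W \<theta> - W (\<theta> + \<omega>)) UNIV"
    by blast
  have "\<nu> * W \<theta> - W (\<theta> + \<omega>) = g \<theta>" for \<theta>
    using has_sum_unique[OF s[of \<theta>, unfolded cancel]] has_sum_Re[OF fourier_inversion[OF g, of \<theta>]] by simp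
  with W show ?thesis by blast
qed

lemma twisted_solution_coeff:
  assumes "\<nu> \<noteq> 1" "\<nu> > 0" and W: "torus_analytic W" and eq: "\<And>\<theta>. \<nu> * W \<theta> - W (\<theta> + \<omega>) = g \<theta>"
  shows "fcoeff (\<lambda>\<theta>. of_real (W \<theta>)) k = fcoeff (\<lambda>\<theta>. of_real (g \<theta>)) k / (of_real \<nu> - mode k \<omega>)"
  using fcoeff_of_equation[OF W eq, of k] twisted_divisor_nonzero[OF assms(1,2), of k \<omega>]
  by (simp add: field_simps)

theorem mainTheorem3:
  fixes \<omega> :: "real ^ 'l::finite"
    and A B \<eta> L :: "real ^ 'l \<Rightarrow> real"
    and Lbar \<nu> :: real
  assumes "diophantine \<omega>"
    and "torus_analytic A" and "torus_analytic B" and "torus_analytic \<eta>"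
    and "\<And>\<theta>. B \<theta> \<noteq> 0"
    and "\<And>\<theta>. A \<theta> / B \<theta> > 0"
  defines "L \<equiv> \<lambda>\<theta>. ln (A \<theta> / B \<theta>)"
    and "Lbar \<equiv> torus_integral L"
    and "\<nu> \<equiv> exp Lbar"
  shows
    "(\<exists>!LC. torus_analytic LC \<and> torus_integral LC = 0 \<and>
        (\<forall>\<theta>. LC \<theta> - LC (\<theta> + \<omega>) = L \<theta> - Lbar)) \<and>
     (\<forall>LC C. torus_analytic LC \<and> torus_integral LC = 0 \<and>
        (\<forall>\<theta>. LC \<theta> - LC (\<theta> + \<omega>) = L \<theta> - Lbar) \<and>
        C = (\<lambda>\<theta>. exp (LC \<theta>)) \<longrightarrow>
        (\<forall>\<theta>. A \<theta> / B \<theta> = \<nu> * (C \<theta> / C (\<theta> + \<omega>))) \<and>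
        (\<nu> \<noteq> 1 \<longrightarrow>
          (\<forall>\<eta>'. \<eta>' = (\<lambda>\<theta>. C (\<theta> + \<omega>) * inverse (B \<theta>) * \<eta> \<theta>) \<longrightarrow>
            (\<exists>!W. torus_analytic W \<and> (\<forall>\<theta>. \<nu> * W \<theta> - W (\<theta> + \<omega>) = \<eta>' \<theta>)) \<and>
            (\<forall>W \<Delta>. torus_analytic W \<and> (\<forall>\<theta>. \<nu> * W \<theta> - W (\<theta> + \<omega>) = \<eta>' \<theta>) \<and>
               \<Delta> = (\<lambda>\<theta>. inverse (C \<theta>) * W \<theta>) \<longrightarrow>
               (\<forall>k. fourier_coeff W k =
                  fourier_coeff \<eta>' k /
                    (of_real \<nu> - exp (2 * of_real pi * \<i> * of_real (ivec k \<bullet> \<omega>)))) \<and>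
               (\<forall>\<theta>. A \<theta> * \<Delta> \<theta> - \<Delta> (\<theta> + \<omega>) * B \<theta> = \<eta> \<theta>)))))"
proof -
  have AB: "torus_analytic (\<lambda>\<theta>. A \<theta> / B \<theta>)"
    using torus_analytic_mult[OF assms(2) torus_analytic_inverse[OF assms(3,5)]]
    by (simp add: divide_inverse)
  have L: "torus_analytic L" unfolding L_def by (rule torus_analytic_ln[OF AB assms(6)])
  have \<nu>: "\<nu> > 0" by (simp add: \<nu>_def)
  have part1: "\<exists>!LC. torus_analytic LC \<and> torus_integral LC = 0 \<and>
        (\<forall>\<theta>. LC \<theta> - LC (\<theta> + \<omega>) = L \<theta> - Lbar)"
  proof (rule ex_ex1I)
    show "\<exists>LC. torus_analytic LC \<and> torus_integral LC = 0 \<and> (\<forall>\<theta>. LC \<theta> - LC (\<theta> + \<omega>) = L \<theta> - Lbar)"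
      unfolding Lbar_def by (rule zero_average_solution_exists[OF assms(1) L])
  next
    fix V W
    assume V: "torus_analytic V \<and> torus_integral V = 0 \<and> (\<forall>\<theta>. V \<theta> - V (\<theta> + \<omega>) = L \<theta> - Lbar)"
      and W: "torus_analytic W \<and> torus_integral W = 0 \<and> (\<forall>\<theta>. W \<theta> - W (\<theta> + \<omega>) = L \<theta> - Lbar)"
    show "V = W"
      by (rule zero_average_solution_unique[OF assms(1), of V "\<lambda>\<theta>. L \<theta> - Lbar"]) (use V W in auto)
  qed
  have ratio: "A \<theta> / B \<theta> = \<nu> * (exp (LC \<theta>) / exp (LC (\<theta> + \<omega>)))"
    if "\<forall>\<theta>. LC \<theta> - LC (\<theta> + \<omega>) = L \<theta> - Lbar" for LC \<theta>
  proof -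
    have "A \<theta> / B \<theta> = exp (L \<theta>)" using assms(6)[of \<theta>] by (simp add: L_def)
    also have "L \<theta> = Lbar + (LC \<theta> - LC (\<theta> + \<omega>))" using that by simp
    finally show ?thesis by (simp only: exp_add exp_diff \<nu>_def)
  qed
  have part2: "(\<exists>!W. torus_analytic W \<and> (\<forall>\<theta>. \<nu> * W \<theta> - W (\<theta> + \<omega>) = g \<theta>)) \<and>
     (\<forall>W \<Delta>. torus_analytic W \<and> (\<forall>\<theta>. \<nu> * W \<theta> - W (\<theta> + \<omega>) = g \<theta>) \<and>
               \<Delta> = (\<lambda>\<theta>. inverse (exp (LC \<theta>)) * W \<theta>) \<longrightarrow>
               (\<forall>k. fourier_coeff W k = fourier_coeff g k /
                    (of_real \<nu> - exp (2 * of_real pi * \<i> * of_real (ivec k \<bullet> \<omega>)))) \<and>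
               (\<forall>\<theta>. A \<theta> * \<Delta> \<theta> - \<Delta> (\<theta> + \<omega>) * B \<theta> = \<eta> \<theta>))"
    if LC: "torus_analytic LC" "\<forall>\<theta>. LC \<theta> - LC (\<theta> + \<omega>) = L \<theta> - Lbar" and \<nu>1: "\<nu> \<noteq> 1"
      and g_def: "g = (\<lambda>\<theta>. exp (LC (\<theta> + \<omega>)) * inverse (B \<theta>) * \<eta> \<theta>)" for LC g
  proof -
    have g: "torus_analytic g" unfolding g_def
      by (intro torus_analytic_mult torus_analytic_exp torus_analytic_shift torus_analytic_inverse LC(1) assms)
    have ex: "\<exists>!W. torus_analytic W \<and> (\<forall>\<theta>. \<nu> * W \<theta> - W (\<theta> + \<omega>) = g \<theta>)"
    proof (rule ex_ex1I)
      show "\<exists>W. torus_analytic W \<and> (\<forall>\<theta>. \<nu> * W \<theta> - W (\<theta> + \<omega>) = g \<theta>)"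
        by (rule twisted_solution_exists[OF \<nu>1 \<nu> g])
    next
      fix V W
      assume V: "torus_analytic V \<and> (\<forall>\<theta>. \<nu> * V \<theta> - V (\<theta> + \<omega>) = g \<theta>)"
        and W: "torus_analytic W \<and> (\<forall>\<theta>. \<nu> * W \<theta> - W (\<theta> + \<omega>) = g \<theta>)"
      have "fcoeff (\<lambda>\<theta>. of_real (V \<theta>)) k = fcoeff (\<lambda>\<theta>. of_real (W \<theta>)) k" for k
        using twisted_solution_coeff[OF \<nu>1 \<nu>, of V \<omega> g k] twisted_solution_coeff[OF \<nu>1 \<nu>, of W \<omega> g k] V W by simp
      then show "V = W" using V W by (intro fcoeff_inject_real) auto
    qed
    have coeffs: "fourier_coeff W k = fourier_coeff g k /
                    (of_real \<nu> - exp (2 * of_real pi * \<i> * of_real (ivec k \<bullet> \<omega>)))"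
      if W: "torus_analytic W" "\<forall>\<theta>. \<nu> * W \<theta> - W (\<theta> + \<omega>) = g \<theta>" for W k
    proof -
      have cont: "continuous_on UNIV f" if "torus_analytic f" for f :: "real ^ 'l \<Rightarrow> real"
        using that by (simp add: torus_analytic_def real_analytic_continuous)
      have "mode k \<omega> = exp (2 * of_real pi * \<i> * of_real (ivec k \<bullet> \<omega>))"
        by (simp add: mode_def cis_conv_exp mult_ac)
      then show ?thesis
        using twisted_solution_coeff[OF \<nu>1 \<nu> W(1), of \<omega> g k] W(2)
        by (simp add: fourier_coeff_eq[OF cont[OF g]] fourier_coeff_eq[OF cont[OF W(1)]])
    qed
    have sol: "A \<theta> * (inverse (exp (LC \<theta>)) * W \<theta>) - (inverse (exp (LC (\<theta> + \<omega>))) * W (\<theta> + \<omega>)) * B \<theta> = \<eta> \<theta>"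
      if W: "\<forall>\<theta>. \<nu> * W \<theta> - W (\<theta> + \<omega>) = g \<theta>" for W \<theta>
    proof -
      let ?C = "exp (LC \<theta>)" and ?C' = "exp (LC (\<theta> + \<omega>))"
      have A: "A \<theta> = \<nu> * (?C / ?C') * B \<theta>" using ratio[OF LC(2), of \<theta>] assms(5)[of \<theta>] by (simp add: field_simps)
      have "A \<theta> * (inverse ?C * W \<theta>) - (inverse ?C' * W (\<theta> + \<omega>)) * B \<theta>
          = B \<theta> / ?C' * (\<nu> * W \<theta> - W (\<theta> + \<omega>))"
        unfolding A by (simp add: field_simps)
      also have "\<dots> = \<eta> \<theta>" using W assms(5)[of \<theta>] by (simp add: g_def)
      finally show ?thesis .
    qed
    show ?thesis using ex coeffs sol by auto
  qed
  show ?thesis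
    by (intro conjI part1 allI impI) (use ratio part2 in auto)
qed

end
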